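(* Let $\mathcal{H}_u$ be a separable Hilbert space, $\mathcal{H}=\mathcal{H}_u\times\mathbb{R}$, $H:\mathcal{H}_u\to\mathbb{R}^{N_d}$ a bounded linear operator, $\bm{d}\in\mathbb{R}^{N_d}$, $\bm{\Gamma}_{\mathrm{noise}}=\tau^{-1}\mathbf{I}$ with $\tau>0$ the covariance of the Gaussian noise $\bm{\epsilon}\sim\mathcal{N}(0,\bm{\Gamma}_{\mathrm{noise}})$, $\mu_0=\mu_0^v\times\mu_0^\lambda$ with $\mu_0^v=\mathcal{N}(0,\mathcal{C}_0)$ and $\mu_0^\lambda=\mathcal{N}(\bar\lambda,\sigma)$, $\Phi(v,\lambda)=\frac12\|\bm{d}-\lambda Hv\|^2_{\bm{\Gamma}_{\mathrm{noise}}}$, and let $\mu$ be the posterior probability measure given by $\frac{d\mu}{d\mu_0}(v,\lambda)=\frac1{Z_\mu}\exp(-\Phi(v,\lambda))$. Let $\mathcal{A}_v$ and $\mathcal{A}_\lambda$ be the sets of approximating measures defined in the context, and consider the problem $$\mathop{\arg\min}_{\nu^v\in\mathcal{A}_v,\ \nu^\lambda\in\mathcal{A}_\lambda}D_{\mathrm{KL}}\big(\nu^v\times\nu^\lambda\,\big\|\,\mu\big).\qquad(\ast)$$ If the approximate probability measures in problem $(\ast)$ satisfy Assumption (A) of the context, then problem $(\ast)$ possesses a solution $\nu=\nu^v\times\nu^\lambda\in\mathcal{M}(\mathcal{H})$ of the form $$\frac{d\nu}{d\mu_0}(v,\lambda)\propto\exp\big(-(\Phi_v(v)+\Phi_\lambda(\lambda))\big),$$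 where $$\Phi_v(v)=\int_{\mathbb{R}}\Phi(v,\lambda)\,\nu^\lambda(d\lambda)+\mathrm{Const},\qquad \Phi_\lambda(\lambda)=\int_{\mathcal{H}_u}\Phi(v,\lambda)\,\nu^v(dv)+\mathrm{Const},$$ and each $\mathrm{Const}$ is a constant not depending on $v$, respectively $\lambda$. Furthermore, $$\nu^v(dv)\propto\exp(-\Phi_v(v))\,\mu_0^v(dv),\qquad \nu^\lambda(d\lambda)\propto\exp(-\Phi_\lambda(\lambda))\,\mu_0^\lambda(d\lambda).$$
   Context: $\mathcal{N}(m,\mathcal{C})$ is the Gaussian measure with mean $m$ and covariance $\mathcal{C}$; $\mathcal{C}_0$ is a positive definite, symmetric, trace-class operator on $\mathcal{H}_u$; $\bar\lambda\in\mathbb{R}$, $\sigma>0$. $\|x\|^2_{\bm{\Gamma}_{\mathrm{noise}}}=\|\bm{\Gamma}_{\mathrm{noise}}^{-1/2}x\|^2$ with $\|\cdot\|$ the Euclidean norm. $\mathcal{M}(\mathcal{X})$ is the set of Borel probability measures on $\mathcal{X}$. $D_{\mathrm{KL}}(\nu\|\mu)=\int\log\big(\frac{d\nu}{d\mu}\big)\frac{d\nu}{d\mu}\,d\mu$ if $\nu\ll\mu$, and $+\infty$ otherwise. "Equivalent" measures means mutually absolutely continuous. For $N>0$ put $T^v_N=\{v\in\mathcal{H}_u: 1/N\le\|v\|_{\mathcal{H}_u}\le N\}$ and $T^\lambda_N=\{\lambda\in\mathbb{R}:-N\le\lambda\le N\}$, which satisfy $\sup_N\mu_0^v(T_N^v)=1$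 and $\sup_N\mu_0^\lambda(T_N^\lambda)=1$. Define $R^1_v=\{\Phi_v:\ \sup_{v\in T^v_N}\Phi_v(v)<\infty\ \ \forall N>0\}$, $R^2_v=\{\Phi_v:\ \int_{\mathcal{H}_u}\exp(-\Phi_v(v))\max(1,\|v\|^2_{\mathcal{H}_u})\,\mu_0^v(dv)<\infty\}$, $R^1_\lambda=\{\Phi_\lambda:\ \sup_{\lambda\in T^\lambda_N}\Phi_\lambda(\lambda)<\infty\ \ \forall N>0\}$, $R^2_\lambda=\{\Phi_\lambda:\ \int_{\mathbb{R}}\exp(-\Phi_\lambda(\lambda))\max(1,\lambda^2)\,\mu_0^\lambda(d\lambda)<\infty\}$. $\mathcal{A}_v$ is the set of $\nu^v\in\mathcal{M}(\mathcal{H}_u)$ equivalent to $\mu_0^v$ with $\frac{d\nu^v}{d\mu_0^v}(v)=\frac{1}{Z^v_\nu}\exp(-\Phi_v(v))$, $Z^v_\nu=\mathbb{E}^{\mu_0^v}[\exp(-\Phi_v)]$, for some $\Phi_v\in R^1_v\cap R^2_v$. $\mathcal{A}_\lambda$ is the set of $\nu^\lambda\in\mathcal{M}(\mathbb{R})$ equivalent to $\mu_0^\lambda$ with $\frac{d\nu^\lambda}{d\mu_0^\lambda}(\lambda)=\frac{1}{Z^\lambda_\nu}\exp(-\Phi_\lambda(\lambda))$, $Z^\lambda_\nu=\mathbb{E}^{\mu_0^\lambda}[\exp(-\Phi_\lambda)]$, for some $\Phi_\lambda\in R^1_\lambda\cap R^2_\lambda$. Assumption (A): for the approximate measures $\nu^v\in\mathcal{A}_v$,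 $\nu^\lambda\in\mathcal{A}_\lambda$, with $A=\{(v,\lambda):\Phi(v,\lambda)\ge0\}$ and for every $N>0$, $$\sup_{v\in T^v_N}\int_{\mathbb{R}}\Phi(v,\lambda)1_A(v,\lambda)\,\nu^\lambda(d\lambda)<\infty,\qquad \sup_{\lambda\in T^\lambda_N}\int_{\mathcal{H}_u}\Phi(v,\lambda)1_A(v,\lambda)\,\nu^v(dv)<\infty,$$ $$\int_{\mathcal{H}_u}\exp\Big(-\int_{\mathbb{R}}\Phi(v,\lambda)\,\nu^\lambda(d\lambda)\Big)\max(1,\|v\|^2_{\mathcal{H}_u})\,\mu_0^v(dv)<\infty,$$ $$\int_{\mathbb{R}}\exp\Big(-\int_{\mathcal{H}_u}\Phi(v,\lambda)\,\nu^v(dv)\Big)\max(1,\lambda^2)\,\mu_0^\lambda(d\lambda)<\infty.$$ *)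

theory Defs
  imports "HOL-Probability.Probability"
begin

definition borel_probs :: "'a::topological_space measure set" where
  "borel_probs = {\<nu>. prob_space \<nu> \<and> sets \<nu> = sets borel}"

definition pos_def_op :: "('a::real_inner \<Rightarrow> 'a) \<Rightarrow> bool" where
  "pos_def_op C \<longleftrightarrow> (\<forall>x. x \<noteq> 0 \<longrightarrow> 0 < inner (C x) x)"

definition symmetric_op :: "('a::real_inner \<Rightarrow> 'a) \<Rightarrow> bool" where
  "symmetric_op C \<longleftrightarrow> (\<forall>x y. inner (C x) y = inner x (C y))"

text \<open>Trace-class operators on a Hilbert space, defined as the nuclear operators: absolutely convergent
  sums of rank-one operators, with functionals represented by vectors through Riesz' theorem.\<close>

definition trace_class_op :: "('a::real_inner \<Rightarrow> 'a) \<Rightarrow> bool" where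
  "trace_class_op C \<longleftrightarrow> bounded_linear C \<and>
     (\<exists>a b :: nat \<Rightarrow> 'a. summable (\<lambda>n. norm (a n) * norm (b n)) \<and>
        (\<forall>x. (\<lambda>n. inner (a n) x *\<^sub>R b n) sums C x))"

text \<open>The second parameter is the variance, whereas \<^const>\<open>normal_density\<close> takes the standard
  deviation. Variance 0 gives the Dirac measure.\<close>

definition gaussian_real :: "real \<Rightarrow> real \<Rightarrow> real measure" where
  "gaussian_real m s =
     (if s = 0 then return borel m else density lborel (\<lambda>x. ennreal (normal_density m (sqrt s) x)))"

text \<open>\<open>\<gamma> = N(m, C)\<close> for a symmetric nonnegative \<open>C\<close>: every one-dimensional marginal is Gaussian,
  with mean and variance given by \<open>m\<close> and \<open>C\<close>.\<close>

definition is_gaussian :: "'a::real_inner \<Rightarrow> ('a \<Rightarrow> 'a) \<Rightarrow> 'a measure \<Rightarrow> bool" where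
  "is_gaussian m C \<gamma> \<longleftrightarrow> \<gamma> \<in> borel_probs \<and>
     (\<forall>h. distr \<gamma> borel (\<lambda>x. inner x h) = gaussian_real (inner m h) (inner (C h) h))"

text \<open>\<open>d\<nu>/d\<mu> = f\<close>, as an equality of \<open>\<mu>\<close>-equivalence classes; only used for \<open>f \<ge> 0\<close>. Note the
  argument order of the library: \<^term>\<open>absolutely_continuous \<mu> \<nu>\<close> says that \<open>\<nu>\<close> is absolutely
  continuous with respect to \<open>\<mu>\<close>, and \<^term>\<open>RN_deriv \<mu> \<nu>\<close> is \<open>d\<nu>/d\<mu>\<close>.\<close>

definition has_RN_deriv :: "'a measure \<Rightarrow> 'a measure \<Rightarrow> ('a \<Rightarrow> real) \<Rightarrow> bool" where
  "has_RN_deriv \<nu> \<mu> f \<longleftrightarrow> sets \<nu> = sets \<mu> \<and> absolutely_continuous \<mu> \<nu> \<and>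
     (AE x in \<mu>. RN_deriv \<mu> \<nu> x = ennreal (f x))"

text \<open>\<open>D\<^sub>K\<^sub>L(\<nu> \<parallel> \<mu>)\<close> with values in the extended reals. \<^term>\<open>KL_divergence (exp 1) \<mu> \<nu>\<close> is the
  real-valued Bochner integral of \<open>log (d\<nu>/d\<mu>)\<close> against \<open>\<nu>\<close>, which is 0 for non-integrable
  integrands. For probability measures the negative part of \<open>(d\<nu>/d\<mu>) log (d\<nu>/d\<mu>)\<close> is bounded and
  hence \<open>\<mu>\<close>-integrable, so non-integrability means that the divergence is \<open>+\<infinity>\<close>.\<close>

definition KL :: "'a measure \<Rightarrow> 'a measure \<Rightarrow> ereal" where
  "KL \<nu> \<mu> =
     (if absolutely_continuous \<mu> \<nu> \<and> integrable \<nu> (entropy_density (exp 1) \<mu> \<nu>)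
      then ereal (KL_divergence (exp 1) \<mu> \<nu>) else \<infinity>)"

text \<open>\<open>\<Gamma>\<^bsup>-1/2\<^esup>\<close> for a symmetric positive definite matrix \<open>\<Gamma>\<close>: the unique symmetric positive definite
  square root of the inverse.\<close>

definition matrix_inv_sqrt :: "real^'n^'n \<Rightarrow> real^'n^'n" where
  "matrix_inv_sqrt \<Gamma> =
     (THE B. transpose B = B \<and> (\<forall>x. x \<noteq> 0 \<longrightarrow> 0 < inner (B *v x) x) \<and> B ** B = matrix_inv \<Gamma>)"

definition noise_norm :: "real^'n^'n \<Rightarrow> real^'n \<Rightarrow> real" where
  "noise_norm \<Gamma> x = norm (matrix_inv_sqrt \<Gamma> *v x)"

definition potential ::
  "real^'n^'n \<Rightarrow> real^'n \<Rightarrow> ('u::real_normed_vector \<Rightarrow> real^'n) \<Rightarrow> 'u \<Rightarrow> real \<Rightarrow> real" where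
  "potential \<Gamma> d H v l = 1/2 * (noise_norm \<Gamma> (d - l *\<^sub>R H v))\<^sup>2"

definition T_v :: "real \<Rightarrow> 'u::real_normed_vector set" where
  "T_v N = {v. 1 / N \<le> norm v \<and> norm v \<le> N}"

definition T_lam :: "real \<Rightarrow> real set" where
  "T_lam N = {l. - N \<le> l \<and> l \<le> N}"

text \<open>The classes \<open>R\<^sup>1\<close>, \<open>R\<^sup>2\<close> and \<open>\<A>\<close> are written once for both factors; they are used with
  \<^const>\<open>T_v\<close> on the Hilbert space and with \<^const>\<open>T_lam\<close> on the reals, where
  \<open>(norm l)\<^sup>2 = l\<^sup>2\<close>. Measurability of the potentials is implicit in the integrals below.\<close>

definition R1 :: "(real \<Rightarrow> 'a::real_normed_vector set) \<Rightarrow> ('a \<Rightarrow> real) set" where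
  "R1 T = {\<phi>. \<phi> \<in> borel_measurable borel \<and> (\<forall>N>0. bdd_above (\<phi> ` T N))}"

definition R2 :: "'a::real_normed_vector measure \<Rightarrow> ('a \<Rightarrow> real) set" where
  "R2 \<mu>0 = {\<phi>. \<phi> \<in> borel_measurable borel \<and>
     (\<integral>\<^sup>+ x. ennreal (exp (- \<phi> x) * max 1 ((norm x)\<^sup>2)) \<partial>\<mu>0) < \<infinity>}"

definition approx_class ::
  "(real \<Rightarrow> 'a::real_normed_vector set) \<Rightarrow> 'a measure \<Rightarrow> 'a measure set" where
  "approx_class T \<mu>0 = {\<nu> \<in> borel_probs.
     absolutely_continuous \<mu>0 \<nu> \<and> absolutely_continuous \<nu> \<mu>0 \<and>
     (\<exists>\<phi> \<in> R1 T \<inter> R2 \<mu>0.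
        has_RN_deriv \<nu> \<mu>0 (\<lambda>x. 1 / (\<integral>y. exp (- \<phi> y) \<partial>\<mu>0) * exp (- \<phi> x)))}"

text \<open>In the last two conditions the inner integrals are Bochner integrals; the first two conditions
  make the nonnegative part of the integrand integrable.\<close>

definition assumption_A ::
  "('u::real_normed_vector \<Rightarrow> real \<Rightarrow> real) \<Rightarrow> 'u measure \<Rightarrow> real measure \<Rightarrow>
   'u measure \<Rightarrow> real measure \<Rightarrow> bool" where
  "assumption_A \<Phi> \<mu>0v \<mu>0l \<nu>v \<nu>l \<longleftrightarrow>
     (let A = {(v, l). \<Phi> v l \<ge> 0} in
       (\<forall>N>0. (SUP v\<in>T_v N. \<integral>\<^sup>+ l. ennreal (\<Phi> v l * indicator A (v, l)) \<partial>\<nu>l) < \<infinity>) \<and>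
       (\<forall>N>0. (SUP l\<in>T_lam N. \<integral>\<^sup>+ v. ennreal (\<Phi> v l * indicator A (v, l)) \<partial>\<nu>v) < \<infinity>)) \<and>
     (\<integral>\<^sup>+ v. ennreal (exp (- (\<integral>l. \<Phi> v l \<partial>\<nu>l)) * max 1 ((norm v)\<^sup>2)) \<partial>\<mu>0v) < \<infinity> \<and>
     (\<integral>\<^sup>+ l. ennreal (exp (- (\<integral>v. \<Phi> v l \<partial>\<nu>v)) * max 1 (l\<^sup>2)) \<partial>\<mu>0l) < \<infinity>"

end

theory Submission
  imports Defs
begin

text \<open>The potential is quadratic in \<open>\<lambda>\<close>, so a factor \<open>\<nu>\<^sup>\<lambda>\<close> enters the expected potential only through its
  mean \<open>m\<close> and variance \<open>s\<close>. By the Gibbs variational principle, among all pairs with these two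
  moments the divergence is least when \<open>\<nu>\<^sup>\<lambda> = N(m, s)\<close> and \<open>\<nu>\<^sup>v\<close> is the Gibbs measure of the potential
  averaged over \<open>\<nu>\<^sup>\<lambda>\<close>. The problem reduces to minimising a continuous and coercive function of
  \<open>(m, s) \<in> \<real> \<times> (0, \<infinity>)\<close>. At a minimiser the equation for \<open>\<nu>\<^sup>v\<close> holds by construction; replacing
  \<open>\<nu>\<^sup>\<lambda>\<close> by the Gibbs measure of the potential averaged over \<open>\<nu>\<^sup>v\<close> cannot decrease the divergence any
  further, so the equality case of the variational principle gives the equation for \<open>\<nu>\<^sup>\<lambda>\<close>.\<close>

section \<open>The Gibbs variational principle\<close>

text \<open>Writing a density as \<open>exp L\<close> keeps it strictly positive. When
  \<open>L\<close> is integrable against \<open>tilt M L\<close>, that integral is the divergence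
  from \<open>M\<close>.\<close>

abbreviation tilt :: "'a measure \<Rightarrow> ('a \<Rightarrow> real) \<Rightarrow> 'a measure" where
  "tilt M L \<equiv> density M (\<lambda>x. ennreal (exp (L x)))"

abbreviation gibbs :: "'a measure \<Rightarrow> ('a \<Rightarrow> real) \<Rightarrow> 'a measure" where
  "gibbs M f \<equiv> tilt M (\<lambda>x. - f x - ln (\<integral>y. exp (- f y) \<partial>M))"

lemma integral_exp_pos:
  fixes g :: "'a \<Rightarrow> real"
  assumes "prob_space M" and "integrable M (\<lambda>x. exp (g x))"
  shows "0 < (\<integral>x. exp (g x) \<partial>M)"
proof -
  interpret prob_space M by fact
  have "(\<integral>x. exp (g x) \<partial>M) \<noteq> 0"
  proof
    assume "(\<integral>x. exp (g x) \<partial>M) = 0"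
    then have "AE x in M. exp (g x) = 0"
      using integral_nonneg_eq_0_iff_AE[OF assms(2)] by simp
    then have "AE x in M. False" by simp
    then show False by simp
  qed
  moreover have "0 \<le> (\<integral>x. exp (g x) \<partial>M)" by simp
  ultimately show ?thesis by linarith
qed

lemma prob_space_tilt:
  assumes "integrable M (\<lambda>x. exp (L x))" and "(\<integral>x. exp (L x) \<partial>M) = 1"
  shows "prob_space (tilt M L)"
proof
  have [measurable]: "(\<lambda>x. exp (L x)) \<in> borel_measurable M" using assms(1) by simp
  have "emeasure (tilt M L) (space (tilt M L)) = (\<integral>\<^sup>+x. ennreal (exp (L x)) \<partial>M)"
    by (simp add: emeasure_density cong: nn_integral_cong)
  also have "\<dots> = 1" using assms by (simp add: nn_integral_eq_integral)
  finally show "emeasure (tilt M L) (space (tilt M L)) = 1" .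
qed

lemma prob_space_gibbs:
  assumes "prob_space M" and "integrable M (\<lambda>x. exp (- f x))"
  shows "prob_space (gibbs M f)"
  using integral_exp_pos[OF assms] assms(2)
  by (intro prob_space_tilt) (simp_all add: exp_diff)

lemma tilt_normalized:
  fixes f :: "'a \<Rightarrow> real"
  assumes "prob_space M" and "integrable M (\<lambda>x. exp (- f x))"
  shows "exp (- f x - ln (\<integral>y. exp (- f y) \<partial>M)) = 1 / (\<integral>y. exp (- f y) \<partial>M) * exp (- f x)"
  using integral_exp_pos[of M "\<lambda>x. - f x"] assms by (simp add: exp_diff)

lemma integrable_exp_uminus_nonneg:
  fixes f :: "'a \<Rightarrow> real"
  assumes "prob_space M" and [measurable]: "f \<in> borel_measurable M" and "\<And>x. 0 \<le> f x"
  shows "integrable M (\<lambda>x. exp (- f x))"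
proof -
  interpret prob_space M by fact
  show ?thesis by (rule integrable_const_bound[of _ 1]) (use assms in auto)
qed

lemma integral_exp_uminus_nonneg_le_1:
  fixes f :: "'a \<Rightarrow> real"
  assumes "prob_space M" and "f \<in> borel_measurable M" and "\<And>x. 0 \<le> f x"
  shows "(\<integral>x. exp (- f x) \<partial>M) \<le> 1"
proof -
  interpret prob_space M by fact
  have "(\<integral>x. exp (- f x) \<partial>M) \<le> (\<integral>x. 1 \<partial>M)"
    by (rule integral_mono) (use assms integrable_exp_uminus_nonneg[OF assms] in auto)
  then show ?thesis using prob_space by simp
qed

text \<open>\<open>t - 1 - ln t \<ge> 0\<close>, with equality only for \<open>t = 1\<close>, applied to the quotient \<open>t\<close> of the Gibbs
  density by the given one.\<close>

lemma
  fixes L f :: "'a \<Rightarrow> real"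
  assumes M: "prob_space M"
    and L[measurable]: "L \<in> borel_measurable M" and f[measurable]: "f \<in> borel_measurable M"
    and P: "prob_space (tilt M L)"
    and ef: "integrable M (\<lambda>x. exp (- f x))"
    and iL: "integrable (tilt M L) L" and "if": "integrable (tilt M L) f"
  defines "Z \<equiv> \<integral>x. exp (- f x) \<partial>M"
  shows gibbs_variational_le: "- ln Z \<le> (\<integral>x. L x \<partial>tilt M L) + (\<integral>x. f x \<partial>tilt M L)"
    and gibbs_variational_eq: "(\<integral>x. L x \<partial>tilt M L) + (\<integral>x. f x \<partial>tilt M L) = - ln Z \<Longrightarrow>
      tilt M L = tilt M (\<lambda>x. - f x - ln Z)"
proof -
  interpret P: prob_space "tilt M L" by fact
  have Z: "0 < Z" unfolding Z_def by (rule integral_exp_pos[OF M ef])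
  \<comment> \<open>This is the logarithm of the given density over the Gibbs density, so
    \<open>exp (- g x)\<close> is the quotient t and integrates to one.\<close>
  define g where "g x = L x + f x + ln Z" for x
  have [measurable]: "g \<in> borel_measurable M" unfolding g_def by simp
  have ig: "integrable (tilt M L) g" unfolding g_def using iL "if" by simp
  have eg: "exp (L x) * exp (- g x) = exp (- f x) / Z" for x
  proof -
    have "exp (L x) * exp (- g x) = exp (- f x - ln Z)" by (simp add: g_def exp_add[symmetric])
    then show ?thesis using Z by (simp add: exp_diff)
  qed
  have ieg: "integrable (tilt M L) (\<lambda>x. exp (- g x))"
    using ef by (subst integrable_real_density) (simp_all add: eg)
  have "(\<integral>x. exp (- g x) \<partial>tilt M L) = (\<integral>x. exp (- f x) / Z \<partial>M)"
    by (subst integral_real_density) (simp_all add: eg)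
  also have "\<dots> = 1" using Z by (simp add: Z_def)
  finally have eg1: "(\<integral>x. exp (- g x) \<partial>tilt M L) = 1" .
  \<comment> \<open>With t = \<open>exp (- g x)\<close> this is t - 1 - ln t.\<close>
  define r where "r x = g x - (1 - exp (- g x))" for x
  have r0: "0 \<le> r x" for x using exp_ge_add_one_self[of "- g x"] by (simp add: r_def)
  have ir: "integrable (tilt M L) r" unfolding r_def using ig ieg by simp
  have "(\<integral>x. r x \<partial>tilt M L) = (\<integral>x. g x \<partial>tilt M L)"
    unfolding r_def using ig ieg eg1 P.prob_space by simp
  also have "\<dots> = (\<integral>x. L x \<partial>tilt M L) + (\<integral>x. f x \<partial>tilt M L) + ln Z"
    unfolding g_def using iL "if" P.prob_space by simp
  finally have r: "(\<integral>x. r x \<partial>tilt M L) = (\<integral>x. L x \<partial>tilt M L) + (\<integral>x. f x \<partial>tilt M L) + ln Z" .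
  have "0 \<le> (\<integral>x. r x \<partial>tilt M L)" using r0 by simp
  then show "- ln Z \<le> (\<integral>x. L x \<partial>tilt M L) + (\<integral>x. f x \<partial>tilt M L)" using r by simp
  assume "(\<integral>x. L x \<partial>tilt M L) + (\<integral>x. f x \<partial>tilt M L) = - ln Z"
  then have "AE x in tilt M L. r x = 0"
    using r integral_nonneg_eq_0_iff_AE[OF ir] r0 by simp
  \<comment> \<open>The density is positive everywhere, so the equation passes back to
    \<open>M\<close>.\<close>
  then have "AE x in M. r x = 0" by (subst (asm) AE_density) (auto simp: )
  moreover have "L x = - f x - ln Z" if "r x = 0" for x
  proof -
    have "exp (- g x) = 1" by (rule ln_eq_minus_one) (use that in \<open>auto simp: r_def\<close>)
    then show ?thesis by (simp add: g_def)
  qed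
  ultimately have "AE x in M. ennreal (exp (L x)) = ennreal (exp (- f x - ln Z))"
    by (auto elim!: AE_mp)
  then show "tilt M L = tilt M (\<lambda>x. - f x - ln Z)"
    by (intro density_cong) auto
qed

section \<open>Divergence of product measures\<close>

lemma has_RN_deriv_density:
  assumes "sigma_finite_measure M" and "f \<in> borel_measurable M"
  shows "has_RN_deriv (density M (\<lambda>x. ennreal (f x))) M f"
proof -
  interpret sigma_finite_measure M by fact
  have m[measurable]: "(\<lambda>x. ennreal (f x)) \<in> borel_measurable M" using assms(2) by simp
  show ?thesis
    using RN_deriv_unique[OF m refl] absolutely_continuousI_density[OF m]
    by (auto simp: has_RN_deriv_def)
qed

lemma density_has_RN_deriv:
  assumes "sigma_finite_measure M" and "has_RN_deriv N M f" and "f \<in> borel_measurable M"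
  shows "N = density M (\<lambda>x. ennreal (f x))"
proof -
  interpret sigma_finite_measure M by fact
  have m[measurable]: "(\<lambda>x. ennreal (f x)) \<in> borel_measurable M" using assms(3) by simp
  have "N = density M (RN_deriv M N)"
    using assms(2) density_RN_deriv[of N] by (simp add: has_RN_deriv_def)
  also have "\<dots> = density M (\<lambda>x. ennreal (f x))"
    using assms(2) by (intro density_cong) (auto simp: has_RN_deriv_def)
  finally show ?thesis .
qed

text \<open>The second direction holds because \<open>exp\<close> never vanishes. Together the two
  give the equivalence with the prior that \<open>approx_class\<close> demands.\<close>

lemma absolutely_continuous_tilt:
  assumes [measurable]: "L \<in> borel_measurable M"
  shows "absolutely_continuous M (tilt M L)" and "absolutely_continuous (tilt M L) M"
proof -
  show "absolutely_continuous M (tilt M L)" by (intro absolutely_continuousI_density) simp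
  have "A \<in> null_sets M" if "A \<in> null_sets (tilt M L)" for A
  proof -
    have "A \<in> sets M" "AE x in M. x \<notin> A"
      using that by (auto simp: null_sets_density_iff)
    then show ?thesis by (simp add: AE_iff_null_sets)
  qed
  then show "absolutely_continuous (tilt M L) M"
    by (auto simp: absolutely_continuous_def)
qed

lemma
  fixes f :: "'a \<Rightarrow> real"
  assumes N: "prob_space N" and [measurable]: "f \<in> borel_measurable M"
  shows integrable_pair_fst: "integrable (M \<Otimes>\<^sub>M N) (\<lambda>z. f (fst z)) \<longleftrightarrow> integrable M f"
    and integral_pair_fst: "(\<integral>z. f (fst z) \<partial>(M \<Otimes>\<^sub>M N)) = (\<integral>x. f x \<partial>M)"
proof -
  have d: "distr (M \<Otimes>\<^sub>M N) M fst = M" by (rule prob_space.distr_pair_fst[OF N])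
  show "integrable (M \<Otimes>\<^sub>M N) (\<lambda>z. f (fst z)) \<longleftrightarrow> integrable M f"
    using integrable_distr_eq[of fst "M \<Otimes>\<^sub>M N" M f] d by simp
  show "(\<integral>z. f (fst z) \<partial>(M \<Otimes>\<^sub>M N)) = (\<integral>x. f x \<partial>M)"
    using integral_distr[of fst "M \<Otimes>\<^sub>M N" M f] d by simp
qed

lemma
  fixes f :: "'b \<Rightarrow> real"
  assumes M: "prob_space M" and N: "prob_space N" and [measurable]: "f \<in> borel_measurable N"
  shows integrable_pair_snd: "integrable (M \<Otimes>\<^sub>M N) (\<lambda>z. f (snd z)) \<longleftrightarrow> integrable N f"
    and integral_pair_snd: "(\<integral>z. f (snd z) \<partial>(M \<Otimes>\<^sub>M N)) = (\<integral>y. f y \<partial>N)"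
proof -
  interpret M: prob_space M by fact
  interpret N: prob_space N by fact
  interpret P: pair_prob_space M N ..
  show "integrable (M \<Otimes>\<^sub>M N) (\<lambda>z. f (snd z)) \<longleftrightarrow> integrable N f"
    using P.integrable_product_swap_iff[of "\<lambda>z. f (snd z)"] integrable_pair_fst[OF M, of f N]
    by (simp add: case_prod_beta')
  show "(\<integral>z. f (snd z) \<partial>(M \<Otimes>\<^sub>M N)) = (\<integral>y. f y \<partial>N)"
    using P.integral_product_swap[of "\<lambda>z. f (snd z)"] integral_pair_fst[OF M, of f N]
    by (simp add: case_prod_beta')
qed

text \<open>The log-density of the product with respect to the tilted measure is the sum of
  \<open>L1\<close>, \<open>L2\<close>, \<open>\<Phi>\<close> and \<open>c\<close>. Since
  \<open>\<Phi>\<close> is integrable, the divergence is infinite exactly when \<open>L1\<close> or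
  \<open>L2\<close> fails to be integrable.\<close>

lemma KL_pair_tilt:
  fixes L1 :: "'a \<Rightarrow> real" and L2 :: "'b \<Rightarrow> real" and \<Phi> :: "'a \<times> 'b \<Rightarrow> real"
  assumes M1: "prob_space M1" and M2: "prob_space M2"
    and [measurable]: "L1 \<in> borel_measurable M1" "L2 \<in> borel_measurable M2"
      "\<Phi> \<in> borel_measurable (M1 \<Otimes>\<^sub>M M2)"
    and P1: "prob_space (tilt M1 L1)" and P2: "prob_space (tilt M2 L2)"
    and i\<Phi>: "integrable (tilt M1 L1 \<Otimes>\<^sub>M tilt M2 L2) \<Phi>"
    and P: "prob_space (tilt (M1 \<Otimes>\<^sub>M M2) (\<lambda>x. - \<Phi> x - c))"
  shows "KL (tilt M1 L1 \<Otimes>\<^sub>M tilt M2 L2) (tilt (M1 \<Otimes>\<^sub>M M2) (\<lambda>x. - \<Phi> x - c)) =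
    (if integrable (tilt M1 L1) L1 \<and> integrable (tilt M2 L2) L2
     then ereal ((\<integral>x. L1 x \<partial>tilt M1 L1) + (\<integral>y. L2 y \<partial>tilt M2 L2) +
       (\<integral>z. \<Phi> z \<partial>(tilt M1 L1 \<Otimes>\<^sub>M tilt M2 L2)) + c)
     else \<infinity>)"
proof -
  let ?N1 = "tilt M1 L1" and ?N2 = "tilt M2 L2"
  let ?N = "?N1 \<Otimes>\<^sub>M ?N2" and ?M = "tilt (M1 \<Otimes>\<^sub>M M2) (\<lambda>x. - \<Phi> x - c)"
  interpret M1: prob_space M1 by fact
  interpret M2: prob_space M2 by fact
  interpret N1: prob_space ?N1 by fact
  interpret N2: prob_space ?N2 by fact
  interpret N: pair_prob_space ?N1 ?N2 ..
  interpret M: prob_space ?M by fact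
  define E where "E z = L1 (fst z) + L2 (snd z) + \<Phi> z + c" for z
  have E[measurable]: "E \<in> borel_measurable (M1 \<Otimes>\<^sub>M M2)" unfolding E_def by simp
  have N_eq: "?N = density (M1 \<Otimes>\<^sub>M M2) (\<lambda>(x, y). ennreal (exp (L1 x)) * ennreal (exp (L2 y)))"
    by (intro pair_measure_density M2.sigma_finite_measure_axioms N2.sigma_finite_measure_axioms)
      auto
  also have "\<dots> = density (M1 \<Otimes>\<^sub>M M2) (\<lambda>z. ennreal (exp (- \<Phi> z - c)) * ennreal (exp (E z)))"
    by (intro density_cong)
      (auto simp: E_def ennreal_mult[symmetric] exp_add[symmetric])
  also have "\<dots> = tilt ?M E" by (intro density_density_eq[symmetric]) auto
  finally have NE: "?N = tilt ?M E" .
  have ac: "absolutely_continuous ?M ?N"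
    unfolding NE by (intro absolutely_continuousI_density) simp
  have "AE z in ?M. ennreal (exp (E z)) = RN_deriv ?M ?N z"
    by (intro M.RN_deriv_unique) (simp_all add: NE)
  \<comment> \<open>The derivative is determined only up to \<open>?M\<close>-null sets; absolute
    continuity carries the identity to \<open>?N\<close>, against which the entropy density is
    integrated.\<close>
  then have "AE z in ?N. ennreal (exp (E z)) = RN_deriv ?M ?N z"
    using ac by (intro absolutely_continuous_AE[OF _ ac]) simp_all
  then have AE: "AE z in ?N. entropy_density (exp 1) ?M ?N z = E z"
  proof eventually_elim
    case (elim z)
    have "RN_deriv ?M ?N z = ennreal (exp (E z))" using elim by (rule sym)
    then show ?case by (simp add: entropy_density_def log_def)
  qed
  have mN: "entropy_density (exp 1) ?M ?N \<in> borel_measurable ?N"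
    using measurable_entropy_density[of "exp 1" ?M ?N] by (simp add: NE)
  have EN: "E \<in> borel_measurable ?N" by simp
  have int: "integrable ?N (entropy_density (exp 1) ?M ?N) \<longleftrightarrow> integrable ?N E"
    by (intro integrable_cong_AE mN EN AE)
  have KLd: "KL_divergence (exp 1) ?M ?N = (\<integral>z. E z \<partial>?N)"
    unfolding KL_divergence_def by (intro integral_cong_AE mN EN AE)
  have fst: "distr ?N ?N1 fst = ?N1" by (rule N2.distr_pair_fst)
  have i1: "integrable ?N (\<lambda>z. L1 (fst z)) \<longleftrightarrow> integrable ?N1 L1"
    by (rule integrable_pair_fst) (use P2 in simp_all)
  have i2: "integrable ?N (\<lambda>z. L2 (snd z)) \<longleftrightarrow> integrable ?N2 L2"
    by (rule integrable_pair_snd) (use P1 P2 in simp_all)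
  have iE: "integrable ?N E \<longleftrightarrow> integrable ?N1 L1 \<and> integrable ?N2 L2"
  proof
    assume "integrable ?N E"
    then have "integrable ?N (\<lambda>z. E z - \<Phi> z - c)" using i\<Phi> by simp
    then have s: "integrable ?N (\<lambda>z. L1 (fst z) + L2 (snd z))" by (simp add: E_def)
    \<comment> \<open>By Fubini almost every section is integrable, and a section at a fixed
      \<open>x\<close> differs from \<open>L2\<close> by a constant. Subtracting \<open>L2\<close>
      then leaves \<open>L1\<close>.\<close>
    have "AE x in ?N1. integrable ?N2 (\<lambda>y. L1 x + L2 y)" using N.AE_integrable_fst'[OF s] by simp
    then obtain x where "integrable ?N2 (\<lambda>y. L1 x + L2 y)"
      using N1.AE_False by (metis (no_types, lifting) AE_E2 AE_mp eventually_mono)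
    then have "integrable ?N2 (\<lambda>y. (L1 x + L2 y) - L1 x)" by (intro Bochner_Integration.integrable_diff) simp_all
    then have L2: "integrable ?N2 L2" by simp
    then have "integrable ?N (\<lambda>z. (L1 (fst z) + L2 (snd z)) - L2 (snd z))"
      using s i2 by (intro Bochner_Integration.integrable_diff) simp_all
    then have "integrable ?N1 L1" using i1 by simp
    then show "integrable ?N1 L1 \<and> integrable ?N2 L2" using L2 by simp
  next
    assume "integrable ?N1 L1 \<and> integrable ?N2 L2"
    then have "integrable ?N (\<lambda>z. L1 (fst z))" "integrable ?N (\<lambda>z. L2 (snd z))"
      using i1 i2 by auto
    then show "integrable ?N E" unfolding E_def using i\<Phi>
      by (intro Bochner_Integration.integrable_add) simp_all
  qed
  have "(\<integral>z. E z \<partial>?N) = (\<integral>x. L1 x \<partial>?N1) + (\<integral>y. L2 y \<partial>?N2) + (\<integral>z. \<Phi> z \<partial>?N) + c"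
    if "integrable ?N1 L1" "integrable ?N2 L2"
  proof -
    have "(\<integral>z. E z \<partial>?N) = (\<integral>z. L1 (fst z) \<partial>?N) + (\<integral>z. L2 (snd z) \<partial>?N) + (\<integral>z. \<Phi> z \<partial>?N) + c"
      unfolding E_def using that i1 i2 i\<Phi> N.P.prob_space by simp
    then show ?thesis using that i1 i2
      integral_pair_fst[OF P2, of L1 ?N1] integral_pair_snd[OF P1 P2, of L2] by simp
  qed
  then show ?thesis using ac int iE KLd by (simp add: KL_def)
qed

section \<open>The approximating classes\<close>

lemma
  fixes \<phi> :: "'a::real_normed_vector \<Rightarrow> real"
  assumes M: "sets M = sets borel" and \<phi>: "\<phi> \<in> R2 M"
  shows R2_integrable_exp: "integrable M (\<lambda>x. exp (- \<phi> x))"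
    and R2_integrable_square: "integrable M (\<lambda>x. exp (- \<phi> x) * (norm x)\<^sup>2)"
proof -
  have "\<phi> \<in> borel_measurable borel" using \<phi> by (simp add: R2_def)
  then have [measurable]: "\<phi> \<in> borel_measurable M" "norm \<in> borel_measurable M"
    by (simp_all add: measurable_cong_sets[OF M refl])
  have "integrable M (\<lambda>x. exp (- \<phi> x) * max 1 ((norm x)\<^sup>2))"
    using \<phi> by (intro integrableI_nonneg) (auto simp: R2_def)
  then show "integrable M (\<lambda>x. exp (- \<phi> x))" "integrable M (\<lambda>x. exp (- \<phi> x) * (norm x)\<^sup>2)"
    by (rule Bochner_Integration.integrable_bound; auto)+
qed

lemma approx_classI:
  fixes \<phi> :: "'a::{real_normed_vector} \<Rightarrow> real"
  assumes M: "M \<in> borel_probs" and \<phi>: "\<phi> \<in> R1 T" "\<phi> \<in> R2 M"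
  shows "gibbs M \<phi> \<in> approx_class T M"
proof -
  interpret prob_space M using M by (simp add: borel_probs_def)
  have sM: "sets M = sets borel" using M by (simp add: borel_probs_def)
  have "\<phi> \<in> borel_measurable borel" using \<phi> by (simp add: R2_def)
  then have [measurable]: "\<phi> \<in> borel_measurable M"
    by (simp add: measurable_cong_sets[OF sM refl])
  note i = R2_integrable_exp[OF sM \<phi>(2)]
  have "has_RN_deriv (gibbs M \<phi>) M (\<lambda>x. 1 / (\<integral>y. exp (- \<phi> y) \<partial>M) * exp (- \<phi> x))"
    unfolding tilt_normalized[OF prob_space_axioms i]
    by (intro has_RN_deriv_density sigma_finite_measure_axioms) simp
  moreover have "prob_space (gibbs M \<phi>)" by (rule prob_space_gibbs[OF prob_space_axioms i])
  ultimately show ?thesis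
    using \<phi> sM by (auto simp: approx_class_def borel_probs_def absolutely_continuous_tilt)
qed

text \<open>The weight in \<open>R2\<close> dominates the squared norm, and up to a constant the
  Gibbs density is \<open>exp (- \<phi> x)\<close>. These second moments are what makes the
  quadratic misfit integrable.\<close>

lemma gibbs_square_integrable:
  fixes \<phi> :: "'a::real_normed_vector \<Rightarrow> real"
  assumes M: "M \<in> borel_probs" and \<phi>: "\<phi> \<in> R2 M"
  shows "integrable (gibbs M \<phi>) (\<lambda>x. (norm x)\<^sup>2)"
proof -
  interpret prob_space M using M by (simp add: borel_probs_def)
  have sM: "sets M = sets borel" using M by (simp add: borel_probs_def)
  have "\<phi> \<in> borel_measurable borel" using \<phi> by (simp add: R2_def)
  then have [measurable]: "\<phi> \<in> borel_measurable M" "norm \<in> borel_measurable M"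
    by (simp_all add: measurable_cong_sets[OF sM refl])
  show ?thesis
    unfolding tilt_normalized[OF prob_space_axioms R2_integrable_exp[OF sM \<phi>]]
    using R2_integrable_square[OF sM \<phi>] by (subst integrable_real_density)
      (auto simp: mult.assoc intro!: integrable_mult_right integrable_divide AE_I2 divide_nonneg_nonneg)
qed

text \<open>All that is kept of a competitor is a log-density and a finite second moment; the lower
  bound on the divergence is proved from these alone.\<close>

lemma approx_classE:
  fixes M \<nu> :: "'a::real_normed_vector measure"
  assumes M: "M \<in> borel_probs" and \<nu>: "\<nu> \<in> approx_class T M"
  obtains L where "L \<in> borel_measurable M" and "\<nu> = tilt M L" and "prob_space \<nu>"
    and "integrable \<nu> (\<lambda>x. (norm x)\<^sup>2)"
proof -
  interpret prob_space M using M by (simp add: borel_probs_def)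
  have sM: "sets M = sets borel" using M by (simp add: borel_probs_def)
  obtain \<phi> where \<phi>: "\<phi> \<in> R1 T" "\<phi> \<in> R2 M"
    and d: "has_RN_deriv \<nu> M (\<lambda>x. 1 / (\<integral>y. exp (- \<phi> y) \<partial>M) * exp (- \<phi> x))"
    using \<nu> by (auto simp: approx_class_def)
  have "\<phi> \<in> borel_measurable borel" using \<phi> by (simp add: R2_def)
  then have [measurable]: "\<phi> \<in> borel_measurable M" "norm \<in> borel_measurable M"
    by (simp_all add: measurable_cong_sets[OF sM refl])
  have \<nu>_eq: "\<nu> = gibbs M \<phi>"
    unfolding tilt_normalized[OF prob_space_axioms R2_integrable_exp[OF sM \<phi>(2)]]
    by (rule density_has_RN_deriv[OF sigma_finite_measure_axioms d]) simp
  have "integrable \<nu> (\<lambda>x. (norm x)\<^sup>2)"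
    unfolding \<nu>_eq by (rule gibbs_square_integrable[OF M \<phi>(2)])
  then show ?thesis
    by (intro that[of "\<lambda>x. - \<phi> x - ln (\<integral>y. exp (- \<phi> y) \<partial>M)"] \<nu>_eq)
      (use \<nu> in \<open>auto simp: approx_class_def borel_probs_def\<close>)
qed

text \<open>This potential shows that the class is never empty, whatever the moments of \<open>M\<close>.\<close>

lemma gibbs_ln_max_norm_square_approx_class:
  fixes M :: "'a::real_normed_vector measure"
  assumes M: "M \<in> borel_probs" and T: "\<And>N x. x \<in> T N \<Longrightarrow> norm x \<le> N"
  shows "gibbs M (\<lambda>x. ln (max 1 ((norm x)\<^sup>2))) \<in> approx_class T M"
proof (rule approx_classI[OF M])
  interpret prob_space M using M by (simp add: borel_probs_def)
  \<comment> \<open>The weight cancels the exponential, so the integral is the total mass of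
    \<open>M\<close>.\<close>
  show "(\<lambda>x. ln (max 1 ((norm x)\<^sup>2))) \<in> R2 M"
    by (auto simp: R2_def exp_minus emeasure_space_1 less_top[symmetric])
  have "bdd_above ((\<lambda>x. ln (max 1 ((norm x)\<^sup>2))) ` T N)" if "0 < N" for N
    using T[of _ N] by (intro bdd_aboveI2[where M = "ln (max 1 (N\<^sup>2))"])
      (force simp: power_mono max.coboundedI2)
  then show "(\<lambda>x. ln (max 1 ((norm x)\<^sup>2))) \<in> R1 T"
    by (auto simp: R1_def)
qed

lemma T_v_norm_le: "x \<in> T_v N \<Longrightarrow> norm x \<le> N"
  by (simp add: T_v_def)

section \<open>Gaussian measures on the reals\<close>

text \<open>The log-density of N(m, s) with respect to N(m0, s0), where s and s0 are
  variances.\<close>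

definition normal_log_ratio :: "real \<Rightarrow> real \<Rightarrow> real \<Rightarrow> real \<Rightarrow> real \<Rightarrow> real" where
  "normal_log_ratio m0 s0 m s x = ln (s0 / s) / 2 - (x - m)\<^sup>2 / (2 * s) + (x - m0)\<^sup>2 / (2 * s0)"

text \<open>The closed form of the divergence of N(m, s) from N(m0, s0).\<close>

definition normal_KL :: "real \<Rightarrow> real \<Rightarrow> real \<Rightarrow> real \<Rightarrow> real" where
  "normal_KL m0 s0 m s = ln (s0 / s) / 2 - 1 / 2 + (s + (m - m0)\<^sup>2) / (2 * s0)"

lemma normal_log_ratio_measurable[measurable]: "normal_log_ratio m0 s0 m s \<in> borel_measurable borel"
  by (simp add: normal_log_ratio_def[abs_def])

lemma gaussian_real_borel_probs:
  assumes "0 < s"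
  shows "gaussian_real m s \<in> borel_probs"
  using assms prob_space_normal_density[of "sqrt s" m] by (simp add: gaussian_real_def borel_probs_def)

lemma gaussian_real_eq_tilt:
  assumes "0 < s0" and "0 < s"
  shows "gaussian_real m s = tilt (gaussian_real m0 s0) (normal_log_ratio m0 s0 m s)"
proof -
  have "normal_density m0 (sqrt s0) x * exp (normal_log_ratio m0 s0 m s x) = normal_density m (sqrt s) x" for x
  proof -
    \<comment> \<open>The quadratic exponents are kept opaque, so that only the square roots of the
      variances are left to simplify.\<close>
    define b c where "b = (x - m)\<^sup>2 / (2 * s)" and "c = (x - m0)\<^sup>2 / (2 * s0)"
    have "exp (ln (s0 / s) / 2) = sqrt (s0 / s)"
      using assms by (simp add: powr_half_sqrt[symmetric] powr_def)
    moreover have "normal_log_ratio m0 s0 m s x = ln (s0 / s) / 2 + - b + c"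
      by (simp add: normal_log_ratio_def b_def c_def)
    ultimately have "exp (normal_log_ratio m0 s0 m s x) = sqrt (s0 / s) * exp (- b) * exp c"
      by (simp only: exp_add)
    moreover have "normal_density m0 (sqrt s0) x = 1 / sqrt (2 * pi * s0) * exp (- c)"
      using assms by (simp add: normal_density_def c_def)
    moreover have "normal_density m (sqrt s) x = 1 / sqrt (2 * pi * s) * exp (- b)"
      using assms by (simp add: normal_density_def b_def)
    moreover have "1 / sqrt (2 * pi * s0) * exp (- c) * (sqrt (s0 / s) * exp (- b) * exp c) =
        1 / sqrt (2 * pi * s) * exp (- b)"
      using assms by (simp add: real_sqrt_divide real_sqrt_mult exp_minus field_simps)
    ultimately show ?thesis by (simp only:)
  qed
  then show ?thesis
    using assms by (simp add: gaussian_real_def density_density_eq ennreal_mult[symmetric] normal_density_nonneg)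
qed

lemma normal_moments:
  assumes "0 < s"
  shows "integrable (gaussian_real m s) (\<lambda>x. x\<^sup>2)" and "(\<integral>x. x \<partial>gaussian_real m s) = m"
    and "(\<integral>x. (x - m)\<^sup>2 \<partial>gaussian_real m s) = s"
proof -
  have s: "0 < sqrt s" using assms by simp
  have g: "gaussian_real m s = density lborel (normal_density m (sqrt s))"
    using assms by (simp add: gaussian_real_def)
  interpret prob_space "gaussian_real m s"
    using gaussian_real_borel_probs[OF assms] by (simp add: borel_probs_def)
  show "(\<integral>x. x \<partial>gaussian_real m s) = m"
    using integral_normal_moment_nz_1[OF s, of m] by (simp add: g integral_real_density normal_density_nonneg)
  show "(\<integral>x. (x - m)\<^sup>2 \<partial>gaussian_real m s) = s"
    using integral_normal_moment_even[OF s, of m 1] assms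
    by (simp add: g integral_real_density normal_density_nonneg)
  have 1: "integrable (gaussian_real m s) (\<lambda>x. x)"
    using integrable_normal_moment_nz_1[OF s, of m]
    by (simp add: g integrable_real_density normal_density_nonneg)
  have 2: "integrable (gaussian_real m s) (\<lambda>x. (x - m)\<^sup>2)"
    using integrable_normal_moment[OF s, of m 2]
    by (simp add: g integrable_real_density normal_density_nonneg)
  have "integrable (gaussian_real m s) (\<lambda>x. (x - m)\<^sup>2 + (2 * m) * x - m\<^sup>2)"
    using 1 2 by simp
  then show "integrable (gaussian_real m s) (\<lambda>x. x\<^sup>2)"
    by (simp add: power2_eq_square algebra_simps)
qed

text \<open>Centred at the mean, the linear term integrates to zero, so \<open>M\<close> enters only
  through \<open>m\<close> and \<open>s\<close>. This is applied both to the Gaussian log-density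
  and to the misfit as a function of \<lambda>.\<close>

lemma
  fixes M :: "real measure"
  assumes M: "prob_space M" "sets M = sets borel" and i: "integrable M (\<lambda>x. x\<^sup>2)"
    and m: "(\<integral>x. x \<partial>M) = m" and s: "(\<integral>x. (x - m)\<^sup>2 \<partial>M) = s"
  shows integrable_quadratic: "integrable M (\<lambda>x. a + b * (x - m) + c * (x - m)\<^sup>2)"
    and integral_quadratic: "(\<integral>x. a + b * (x - m) + c * (x - m)\<^sup>2 \<partial>M) = a + c * s"
proof -
  interpret prob_space M by fact
  have "(\<lambda>x. x) \<in> borel_measurable M" by (simp add: measurable_cong_sets[OF M(2) refl])
  then have i1: "integrable M (\<lambda>x. x)" using i by (rule square_integrable_imp_integrable)
  have "integrable M (\<lambda>x. x\<^sup>2 - 2 * m * x + m\<^sup>2)" using i i1 by simp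
  then have i2: "integrable M (\<lambda>x. (x - m)\<^sup>2)" by (simp add: power2_eq_square algebra_simps)
  show "integrable M (\<lambda>x. a + b * (x - m) + c * (x - m)\<^sup>2)" using i1 i2 by simp
  show "(\<integral>x. a + b * (x - m) + c * (x - m)\<^sup>2 \<partial>M) = a + c * s"
    using i1 i2 m s by (simp add: prob_space)
qed

text \<open>Here \<open>M\<close> is any law with mean \<open>m\<close> and variance
  \<open>s\<close>, Gaussian or not: the log-density of the matching Gaussian is quadratic and
  cannot tell them apart.\<close>

lemma
  fixes M :: "real measure"
  assumes M: "prob_space M" "sets M = sets borel" and i: "integrable M (\<lambda>x. x\<^sup>2)"
    and m: "(\<integral>x. x \<partial>M) = m" and s: "(\<integral>x. (x - m)\<^sup>2 \<partial>M) = s" and "0 < s" "0 < s0"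
  shows integrable_normal_log_ratio: "integrable M (normal_log_ratio m0 s0 m s)"
    and integral_normal_log_ratio: "(\<integral>x. normal_log_ratio m0 s0 m s x \<partial>M) = normal_KL m0 s0 m s"
proof -
  \<comment> \<open>Expansion about \<open>m\<close>. Multiplied by \<open>s\<close>, the last
    coefficient yields the term -1/2 of \<open>normal_KL\<close>.\<close>
  have eq: "normal_log_ratio m0 s0 m s = (\<lambda>x. (ln (s0 / s) / 2 + (m - m0)\<^sup>2 / (2 * s0)) + ((m - m0) / s0) * (x - m)
      + (1 / (2 * s0) - 1 / (2 * s)) * (x - m)\<^sup>2)"
  proof
    fix x
    have "(x - m0)\<^sup>2 = (m - m0)\<^sup>2 + 2 * (m - m0) * (x - m) + (x - m)\<^sup>2"
      by (simp add: power2_eq_square algebra_simps)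
    then have "(x - m0)\<^sup>2 / (2 * s0) = (m - m0)\<^sup>2 / (2 * s0) + ((m - m0) / s0) * (x - m) + (x - m)\<^sup>2 / (2 * s0)"
      using \<open>0 < s0\<close> by (simp add: field_simps)
    then show "normal_log_ratio m0 s0 m s x = (ln (s0 / s) / 2 + (m - m0)\<^sup>2 / (2 * s0)) + ((m - m0) / s0) * (x - m)
      + (1 / (2 * s0) - 1 / (2 * s)) * (x - m)\<^sup>2"
      using \<open>0 < s0\<close> \<open>0 < s\<close> by (simp add: normal_log_ratio_def left_diff_distrib)
  qed
  show "integrable M (normal_log_ratio m0 s0 m s)"
    unfolding eq by (rule integrable_quadratic[OF M i m s])
  show "(\<integral>x. normal_log_ratio m0 s0 m s x \<partial>M) = normal_KL m0 s0 m s"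
    unfolding eq integral_quadratic[OF M i m s] normal_KL_def
    using \<open>0 < s0\<close> \<open>0 < s\<close> by (simp add: field_simps)
qed

section \<open>The noise norm\<close>

lemma mat_vector_mult: "mat a *v x = a *\<^sub>R (x :: real^'n)"
  by (simp add: matrix_vector_mult_def mat_def vec_eq_iff mult_delta_left)

text \<open>The definite description needs uniqueness of the positive definite root among all
  matrices, not only among scalar ones.\<close>

lemma matrix_inv_sqrt_mat:
  assumes "0 < c"
  shows "matrix_inv_sqrt (mat (inverse c) :: real^'n^'n) = mat (sqrt c)"
proof -
  have mm: "mat a ** mat b = (mat (a * b) :: real^'n^'n)" for a b :: real
    by (simp add: matrix_eq matrix_vector_mul_assoc[symmetric] mat_vector_mult)
  note mv = mat_vector_mult
  have inv: "matrix_inv (mat (inverse c) :: real^'n^'n) = mat c"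
  proof -
    have "\<exists>A'. (mat (inverse c) :: real^'n^'n) ** A' = mat 1 \<and> A' ** mat (inverse c) = mat 1"
      using assms by (intro exI[of _ "mat c"]) (simp add: mm)
    then have "(mat (inverse c) :: real^'n^'n) ** matrix_inv (mat (inverse c)) = mat 1"
      unfolding matrix_inv_def by (rule someI2_ex) simp
    then have "mat c ** ((mat (inverse c) :: real^'n^'n) ** matrix_inv (mat (inverse c))) = mat c"
      by simp
    then show ?thesis using assms by (simp add: matrix_mul_assoc mm)
  qed
  show ?thesis
    unfolding matrix_inv_sqrt_def inv
  proof (rule the_equality)
    show "transpose (mat (sqrt c)) = (mat (sqrt c) :: real^'n^'n) \<and>
      (\<forall>x. x \<noteq> 0 \<longrightarrow> 0 < (mat (sqrt c) *v x) \<bullet> x) \<and> mat (sqrt c) ** mat (sqrt c) = (mat c :: real^'n^'n)"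
      using assms by (simp add: mm mv)
  next
    fix B :: "real^'n^'n"
    assume B: "transpose B = B \<and> (\<forall>x. x \<noteq> 0 \<longrightarrow> 0 < (B *v x) \<bullet> x) \<and> B ** B = mat c"
    have "B *v x = sqrt c *\<^sub>R x" for x
    proof -
      \<comment> \<open>From \<open>B ** B = mat c\<close>, applying \<open>B\<close> to
        \<open>y\<close> gives -sqrt c times \<open>y\<close>. Positive definiteness excludes a
        negative eigenvalue, so \<open>y\<close> is zero.\<close>
      define y where "y = B *v x - sqrt c *\<^sub>R x"
      have "B *v (B *v x) = c *\<^sub>R x" using B by (simp add: matrix_vector_mul_assoc mv)
      then have "B *v y = - sqrt c *\<^sub>R y"
        using assms by (simp add: y_def matrix_vector_mult_diff_distrib matrix_vector_mult_scaleR algebra_simps)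
      then have "(B *v y) \<bullet> y = - (sqrt c * (y \<bullet> y))" by simp
      then have "(B *v y) \<bullet> y \<le> 0" using assms by simp
      then have "y = 0" using B by fastforce
      then show ?thesis by (simp add: y_def)
    qed
    then show "B = mat (sqrt c)" by (simp add: matrix_eq mv)
  qed
qed

lemma potential_white_noise:
  fixes d :: "real^'n"
  assumes "0 < \<tau>"
  shows "potential (mat (inverse \<tau>)) d H v l = \<tau> / 2 * (norm (d - l *\<^sub>R H v))\<^sup>2"
  using assms by (simp add: potential_def noise_norm_def matrix_inv_sqrt_mat mat_vector_mult power_mult_distrib)

section \<open>Reduction to two parameters\<close>

text \<open>\<open>M\<close> is the prior on the Hilbert space, and \<open>m0\<close> and
  \<open>s0\<close> are the mean and variance of the prior of \<lambda>.\<close>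

locale bilinear_inverse_problem =
  fixes H :: "'u::{real_inner, complete_space, second_countable_topology} \<Rightarrow> real^'n"
    and d :: "real^'n" and \<tau> m0 s0 :: real and M :: "'u measure"
  assumes H: "bounded_linear H" and \<tau>: "0 < \<tau>" and s0: "0 < s0" and M: "M \<in> borel_probs"
begin

definition misfit :: "'u \<Rightarrow> real \<Rightarrow> real" where
  "misfit v l = \<tau> / 2 * (norm (d - l *\<^sub>R H v))\<^sup>2"

text \<open>The misfit averaged over a law of \<lambda> with mean \<open>m\<close> and variance
  \<open>s\<close>: squared bias plus a variance term.\<close>

definition mean_misfit :: "real \<Rightarrow> real \<Rightarrow> 'u \<Rightarrow> real" where
  "mean_misfit m s v = \<tau> / 2 * ((norm (d - m *\<^sub>R H v))\<^sup>2 + s * (norm (H v))\<^sup>2)"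

abbreviation "Q \<equiv> gaussian_real m0 s0"

text \<open>The infimum of \<open>KL (\<alpha> \<Otimes>\<^sub>M \<beta>) \<mu>\<close>, up to the constant \<open>ln Z\<close>, over all products in which \<open>\<beta>\<close> has mean \<open>m\<close>
  and variance \<open>s\<close>.\<close>

definition reduced :: "real \<Rightarrow> real \<Rightarrow> real" where
  "reduced m s = normal_KL m0 s0 m s - ln (\<integral>v. exp (- mean_misfit m s v) \<partial>M)"

lemma prob_M: "prob_space M" and sets_M[measurable_cong, simp]: "sets M = sets borel"
  using M by (simp_all add: borel_probs_def)

lemma Q_borel_probs: "Q \<in> borel_probs" and prob_Q: "prob_space Q"
  and sets_Q[measurable_cong, simp]: "sets Q = sets borel"
  using gaussian_real_borel_probs[OF s0] by (simp_all add: borel_probs_def)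

lemma space_priors[simp]: "space M = UNIV" "space Q = UNIV"
  using sets_eq_imp_space_eq[OF sets_M] sets_eq_imp_space_eq[OF sets_Q] by simp_all

lemma H_measurable[measurable]: "H \<in> borel_measurable borel"
  by (intro borel_measurable_continuous_onI linear_continuous_on H)

lemma misfit_measurable[measurable]:
  "(\<lambda>z. misfit (fst z) (snd z)) \<in> borel_measurable (borel \<Otimes>\<^sub>M borel)"
  "misfit v \<in> borel_measurable borel" "(\<lambda>v. misfit v l) \<in> borel_measurable borel"
  "mean_misfit m s \<in> borel_measurable borel"
  unfolding misfit_def mean_misfit_def by simp_all

section \<open>Averages and integrability of the misfit\<close>

lemma misfit_nonneg: "0 \<le> misfit v l" and mean_misfit_nonneg: "0 \<le> s \<Longrightarrow> 0 \<le> mean_misfit m s v"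
  using \<tau> by (simp_all add: misfit_def mean_misfit_def)

lemma
  assumes \<beta>: "prob_space \<beta>" "sets \<beta> = sets borel" "integrable \<beta> (\<lambda>x. x\<^sup>2)"
    and "(\<integral>x. x \<partial>\<beta>) = m" "(\<integral>x. (x - m)\<^sup>2 \<partial>\<beta>) = s"
  shows integrable_misfit_right: "integrable \<beta> (misfit v)"
    and integral_misfit_right: "(\<integral>l. misfit v l \<partial>\<beta>) = mean_misfit m s v"
proof -
  have eq: "misfit v = (\<lambda>l. \<tau> / 2 * (norm (d - m *\<^sub>R H v))\<^sup>2 + (- \<tau> * ((d - m *\<^sub>R H v) \<bullet> H v)) * (l - m)
      + \<tau> / 2 * (norm (H v))\<^sup>2 * (l - m)\<^sup>2)"
  proof
    fix l
    have "d - l *\<^sub>R H v = (d - m *\<^sub>R H v) - (l - m) *\<^sub>R H v" by (simp add: algebra_simps)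
    then have "(norm (d - l *\<^sub>R H v))\<^sup>2 = (norm (d - m *\<^sub>R H v))\<^sup>2
      - 2 * (l - m) * ((d - m *\<^sub>R H v) \<bullet> H v) + (l - m)\<^sup>2 * (norm (H v))\<^sup>2"
      by (simp only: power2_norm_eq_inner inner_diff_left inner_diff_right inner_scaleR_left inner_scaleR_right)
        (simp add: inner_commute power2_eq_square algebra_simps)
    then show "misfit v l = \<tau> / 2 * (norm (d - m *\<^sub>R H v))\<^sup>2 + (- \<tau> * ((d - m *\<^sub>R H v) \<bullet> H v)) * (l - m)
      + \<tau> / 2 * (norm (H v))\<^sup>2 * (l - m)\<^sup>2"
      unfolding misfit_def by (simp only:) (simp add: algebra_simps)
  qed
  show "integrable \<beta> (misfit v)"
    unfolding eq by (rule integrable_quadratic[OF assms])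
  show "(\<integral>l. misfit v l \<partial>\<beta>) = mean_misfit m s v"
    unfolding eq integral_quadratic[OF assms] mean_misfit_def by (simp add: algebra_simps)
qed

text \<open>The bound separates into a product of squares in \<open>l\<close> and \<open>v\<close>,
  so finite second moments of the two factors suffice for integrability.\<close>

lemma misfit_le: "misfit v l \<le> \<tau> * (norm d)\<^sup>2 + \<tau> * (onorm H)\<^sup>2 * (l\<^sup>2 * (norm v)\<^sup>2)"
proof -
  have "norm (d - l *\<^sub>R H v) \<le> norm d + \<bar>l\<bar> * norm (H v)"
    using norm_triangle_ineq4[of d "l *\<^sub>R H v"] by simp
  also have "\<dots> \<le> norm d + \<bar>l\<bar> * (onorm H * norm v)"
    by (intro add_left_mono mult_left_mono onorm[OF H]) simp
  finally have "(norm (d - l *\<^sub>R H v))\<^sup>2 \<le> (norm d + \<bar>l\<bar> * (onorm H * norm v))\<^sup>2"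
    by (intro power_mono) simp_all
  also have "\<dots> \<le> 2 * (norm d)\<^sup>2 + 2 * (\<bar>l\<bar> * (onorm H * norm v))\<^sup>2"
    \<comment> \<open>The square of the difference of the two summands is nonnegative, which bounds
      the mixed term of the square of their sum.\<close>
    using sum_power2_ge_zero[of "norm d - \<bar>l\<bar> * (onorm H * norm v)" 0]
    by (simp add: power2_sum power2_diff)
  finally have "\<tau> / 2 * (norm (d - l *\<^sub>R H v))\<^sup>2 \<le> \<tau> / 2 * (2 * (norm d)\<^sup>2 + 2 * (\<bar>l\<bar> * (onorm H * norm v))\<^sup>2)"
    using \<tau> by (intro mult_left_mono) simp_all
  then show ?thesis by (simp add: misfit_def power_mult_distrib algebra_simps)
qed

lemma norm_misfit_le:
  "norm (misfit v l) \<le> norm (\<tau> * (norm d)\<^sup>2 + \<tau> * (onorm H)\<^sup>2 * (l\<^sup>2 * (norm v)\<^sup>2))"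
  using misfit_le[of v l] misfit_nonneg[of v l] unfolding real_norm_def by linarith

lemma integrable_misfit_left:
  assumes \<alpha>: "prob_space \<alpha>" "sets \<alpha> = sets borel" "integrable \<alpha> (\<lambda>v. (norm v)\<^sup>2)"
  shows "integrable \<alpha> (\<lambda>v. misfit v l)"
proof -
  interpret prob_space \<alpha> by fact
  note \<alpha>(2)[measurable_cong]
  show ?thesis
    by (rule Bochner_Integration.integrable_bound[of _ "\<lambda>v. \<tau> * (norm d)\<^sup>2 + \<tau> * (onorm H)\<^sup>2 * (l\<^sup>2 * (norm v)\<^sup>2)"])
      (intro Bochner_Integration.integrable_add integrable_mult_right \<alpha>(3) integrable_const AE_I2 norm_misfit_le | simp)+
qed

lemma integrable_misfit_pair:
  assumes \<alpha>: "prob_space \<alpha>" "sets \<alpha> = sets borel" "integrable \<alpha> (\<lambda>v. (norm v)\<^sup>2)"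
    and \<beta>: "prob_space \<beta>" "sets \<beta> = sets borel" "integrable \<beta> (\<lambda>x. x\<^sup>2)"
  shows "integrable (\<alpha> \<Otimes>\<^sub>M \<beta>) (\<lambda>z. misfit (fst z) (snd z))"
proof -
  interpret \<alpha>: prob_space \<alpha> by fact
  interpret \<beta>: prob_space \<beta> by fact
  interpret pair_prob_space \<alpha> \<beta> ..
  note \<alpha>(2)[measurable_cong] \<beta>(2)[measurable_cong]
  have [measurable]: "(\<lambda>z. misfit (fst z) (snd z)) \<in> borel_measurable (\<alpha> \<Otimes>\<^sub>M \<beta>)"
    by measurable
  have "integrable (\<alpha> \<Otimes>\<^sub>M \<beta>) (\<lambda>z. (snd z)\<^sup>2 * (norm (fst z))\<^sup>2)"
  proof (rule Fubini_integrable)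
    show "integrable \<alpha> (\<lambda>x. \<integral>y. norm ((snd (x, y))\<^sup>2 * (norm (fst (x, y)))\<^sup>2) \<partial>\<beta>)"
      using \<alpha> \<beta> by (simp add: abs_mult)
  qed (use \<alpha> \<beta> in auto)
  then have "integrable (\<alpha> \<Otimes>\<^sub>M \<beta>)
      (\<lambda>z. \<tau> * (norm d)\<^sup>2 + \<tau> * (onorm H)\<^sup>2 * ((snd z)\<^sup>2 * (norm (fst z))\<^sup>2))"
    by (intro Bochner_Integration.integrable_add integrable_mult_right P.integrable_const)
  then show ?thesis
    by (rule Bochner_Integration.integrable_bound) (auto intro!: norm_misfit_le simp del: real_norm_def)
qed

section \<open>Moments and Gaussian members of the second factor\<close>

text \<open>A vanishing integral would concentrate \<open>tilt Q L\<close>, and hence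
  \<open>Q\<close>, at \<open>m\<close>, but \<open>Q\<close> has a Lebesgue density and no atoms.
  This keeps the parameter \<open>s\<close> of a competitor in the open half-line.\<close>

lemma variance_pos:
  assumes [measurable]: "L \<in> borel_measurable Q" and "prob_space (tilt Q L)"
    and "integrable (tilt Q L) (\<lambda>x. x\<^sup>2)"
  shows "0 < (\<integral>x. (x - m)\<^sup>2 \<partial>tilt Q L)"
proof -
  interpret Q: prob_space Q by (rule prob_Q)
  interpret \<beta>: prob_space "tilt Q L" by fact
  have "integrable (tilt Q L) (\<lambda>x. x)"
    by (rule \<beta>.square_integrable_imp_integrable[OF _ assms(3)]) measurable
  then have "integrable (tilt Q L) (\<lambda>x. x\<^sup>2 - 2 * m * x + m\<^sup>2)"
    by (intro Bochner_Integration.integrable_add Bochner_Integration.integrable_diff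
        integrable_mult_right assms(3) \<beta>.integrable_const)
  then have i: "integrable (tilt Q L) (\<lambda>x. (x - m)\<^sup>2)" by (simp add: power2_diff algebra_simps)
  have "(\<integral>x. (x - m)\<^sup>2 \<partial>tilt Q L) \<noteq> 0"
  proof
    have Q: "Q = density lborel (\<lambda>x. ennreal (normal_density m0 (sqrt s0) x))"
      using s0 by (simp add: gaussian_real_def)
    assume "(\<integral>x. (x - m)\<^sup>2 \<partial>tilt Q L) = 0"
    then have "AE x in tilt Q L. x = m" using integral_nonneg_eq_0_iff_AE[OF i] by simp
    then have "AE x in Q. x = m" by (subst (asm) AE_density) simp_all
    moreover have "AE x in Q. x \<noteq> m"
      unfolding Q using AE_lborel_singleton[of m] by (subst AE_density) auto
    ultimately have "AE x in Q. False" by eventually_elim simp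
    then show False by simp
  qed
  moreover have "0 \<le> (\<integral>x. (x - m)\<^sup>2 \<partial>tilt Q L)" by simp
  ultimately show ?thesis by linarith
qed

text \<open>The potential is minus a normalised log-density, so its normaliser is one. This brings a
  Gaussian into the form that the variational principle and \<open>approx_classI\<close>
  expect.\<close>

lemma gaussian_real_gibbs:
  assumes s: "0 < s"
  shows "integrable Q (\<lambda>x. exp (- (- normal_log_ratio m0 s0 m s x)))"
    and "(\<integral>x. exp (- (- normal_log_ratio m0 s0 m s x)) \<partial>Q) = 1"
    and "gaussian_real m s = gibbs Q (\<lambda>x. - normal_log_ratio m0 s0 m s x)"
proof -
  have g: "gaussian_real m s = tilt Q (normal_log_ratio m0 s0 m s)"
    by (rule gaussian_real_eq_tilt[OF s0 s])
  have "prob_space (tilt Q (normal_log_ratio m0 s0 m s))"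
    using gaussian_real_borel_probs[OF s] by (simp add: borel_probs_def flip: g)
  then have "emeasure (tilt Q (normal_log_ratio m0 s0 m s)) (space Q) = 1"
    by (drule_tac prob_space.emeasure_space_1) simp
  then have "(\<integral>\<^sup>+x. ennreal (exp (normal_log_ratio m0 s0 m s x)) \<partial>Q) = ennreal 1"
    by (simp add: emeasure_density cong: nn_integral_cong)
  then have one: "has_bochner_integral Q (\<lambda>x. exp (normal_log_ratio m0 s0 m s x)) 1"
    by (rule has_bochner_integral_nn_integral[rotated 3]) simp_all
  then show "integrable Q (\<lambda>x. exp (- (- normal_log_ratio m0 s0 m s x)))"
    and 1: "(\<integral>x. exp (- (- normal_log_ratio m0 s0 m s x)) \<partial>Q) = 1"
    by (simp_all add: has_bochner_integral_iff)
  show "gaussian_real m s = gibbs Q (\<lambda>x. - normal_log_ratio m0 s0 m s x)"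
    unfolding 1 using g by simp
qed

section \<open>Lower bound for the divergence by the reduced function\<close>

text \<open>For integrable log-densities this is the divergence of the product from the posterior,
  up to the logarithm of the evidence; see \<open>KL_posterior\<close>.\<close>

definition free_energy :: "('u \<Rightarrow> real) \<Rightarrow> (real \<Rightarrow> real) \<Rightarrow> real" where
  "free_energy La Lb = (\<integral>v. La v \<partial>tilt M La) + (\<integral>l. Lb l \<partial>tilt Q Lb)
     + (\<integral>z. misfit (fst z) (snd z) \<partial>(tilt M La \<Otimes>\<^sub>M tilt Q Lb))"

text \<open>Among the \<open>\<beta>\<close> with mean \<open>m\<close> and variance \<open>s\<close>, the Gaussian one has the least divergence from the
  prior, because its log-density is quadratic and so has the same integral against all of them; for
  the same reason the mean misfit depends on \<open>\<beta>\<close> only through \<open>m\<close> and \<open>s\<close>.\<close>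

lemma reduced_le_free_energy:
  assumes La[measurable]: "La \<in> borel_measurable M" and \<alpha>: "prob_space (tilt M La)"
      "integrable (tilt M La) (\<lambda>v. (norm v)\<^sup>2)" "integrable (tilt M La) La"
    and Lb[measurable]: "Lb \<in> borel_measurable Q" and \<beta>: "prob_space (tilt Q Lb)"
      "integrable (tilt Q Lb) (\<lambda>x. x\<^sup>2)" "integrable (tilt Q Lb) Lb"
  shows "\<exists>m s. 0 < s \<and> reduced m s \<le> free_energy La Lb"
proof -
  interpret \<alpha>: prob_space "tilt M La" by fact
  interpret \<beta>: prob_space "tilt Q Lb" by fact
  interpret pair_prob_space "tilt M La" "tilt Q Lb" ..
  define m where "m = (\<integral>x. x \<partial>tilt Q Lb)"
  define s where "s = (\<integral>x. (x - m)\<^sup>2 \<partial>tilt Q Lb)"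
  have s: "0 < s" unfolding s_def by (rule variance_pos[OF Lb \<beta>(1,2)])
  have sets: "sets (tilt M La) = sets borel" "sets (tilt Q Lb) = sets borel" by simp_all
  note mom = \<beta>(1) sets(2) \<beta>(2) m_def[symmetric] s_def[symmetric]
  have R: "(\<lambda>x. - normal_log_ratio m0 s0 m s x) \<in> borel_measurable Q" by simp
  have iR': "integrable (tilt Q Lb) (\<lambda>x. - normal_log_ratio m0 s0 m s x)"
    using integrable_normal_log_ratio[OF mom s s0] by simp
  \<comment> \<open>The normaliser is one, so the left side is zero and the integral of the Gaussian
    log-density is at most that of \<open>Lb\<close>.\<close>
  note gibbs_variational_le[OF prob_Q Lb R \<beta>(1) gaussian_real_gibbs(1)[OF s] \<beta>(3) iR']
  then have 1: "normal_KL m0 s0 m s \<le> (\<integral>l. Lb l \<partial>tilt Q Lb)"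
    unfolding gaussian_real_gibbs(2)[OF s] using integral_normal_log_ratio[OF mom s s0] by simp
  note i = integrable_misfit_pair[OF \<alpha>(1) sets(1) \<alpha>(2) \<beta>(1) sets(2) \<beta>(2)]
  have "(\<integral>v. mean_misfit m s v \<partial>tilt M La) =
      (\<integral>z. misfit (fst z) (snd z) \<partial>(tilt M La \<Otimes>\<^sub>M tilt Q Lb))"
    using integral_fst'[OF i] integral_misfit_right[OF mom] by simp
  moreover have "integrable (tilt M La) (mean_misfit m s)"
    using integrable_fst'[OF i] integral_misfit_right[OF mom] by simp
  \<comment> \<open>The same principle on the Hilbert space, with the misfit averaged over the
    second factor as potential.\<close>
  then have "- ln (\<integral>v. exp (- mean_misfit m s v) \<partial>M) \<le>
     (\<integral>v. La v \<partial>tilt M La) + (\<integral>v. mean_misfit m s v \<partial>tilt M La)"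
    using s by (intro gibbs_variational_le[OF prob_M La _ \<alpha>(1) _ \<alpha>(3)]
        integrable_exp_uminus_nonneg[OF prob_M] mean_misfit_nonneg) simp_all
  ultimately show ?thesis
    using 1 s by (intro exI[of _ m] exI[of _ s]) (simp add: reduced_def free_energy_def)
qed

section \<open>Existence of a minimiser of the reduced function\<close>

text \<open>Coercivity: with x = s / s0, twice the divergence is x - 1 - ln x plus (m - m0)^2 / s0.
  Both parts are nonnegative, so each is at most 2c.\<close>

lemma normal_KL_bounds:
  assumes s: "0 < s" and c: "normal_KL m0 s0 m s \<le> c"
  shows "\<bar>m - m0\<bar> \<le> 2 * s0 * c + 1" and "s0 * exp (- 2 * c - 1) \<le> s" and "s \<le> s0 * (4 * c + 2)"
proof -
  define x where "x = s / s0"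
  have x: "0 < x" "s = s0 * x" using s s0 by (simp_all add: x_def)
  have "normal_KL m0 s0 m s = (x - 1 - ln x + (m - m0)\<^sup>2 / s0) / 2"
    using s0 s by (simp add: normal_KL_def x_def ln_div field_simps)
  then have b: "x - 1 - ln x + (m - m0)\<^sup>2 / s0 \<le> 2 * c" using c by simp
  have ln: "ln x \<le> x - 1" using x(1) by (rule ln_le_minus_one)
  have m: "0 \<le> (m - m0)\<^sup>2 / s0" using s0 by simp
  have "(m - m0)\<^sup>2 / s0 \<le> 2 * c" using b ln by linarith
  then have "(m - m0)\<^sup>2 \<le> 2 * s0 * c" using s0 by (simp add: field_simps)
  \<comment> \<open>This avoids a square root in the bound on \<open>m\<close>.\<close>
  moreover have "\<bar>m - m0\<bar> \<le> (m - m0)\<^sup>2 + 1"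
    using zero_le_power2[of "\<bar>m - m0\<bar> - 1 / 2"] unfolding power2_diff power2_abs by (simp add: power2_eq_square)
  ultimately show "\<bar>m - m0\<bar> \<le> 2 * s0 * c + 1" by linarith
  have "- 2 * c - 1 \<le> ln x" using b m x by linarith
  then have "exp (- 2 * c - 1) \<le> x" using x by (simp add: ln_ge_iff)
  then show "s0 * exp (- 2 * c - 1) \<le> s" using s0 by (simp add: x(2))
  \<comment> \<open>Halving the argument gives ln x at most x / 2, so that x - ln x still grows
    linearly.\<close>
  have "ln (x / 2) \<le> x / 2 - 1" using x by (intro ln_le_minus_one) simp
  moreover have "ln (2::real) \<le> 1" using ln_le_minus_one[of "2::real"] by simp
  ultimately have "ln x \<le> x / 2" using x by (simp add: ln_div)
  then have "x \<le> 4 * c + 2" using b m by linarith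
  then show "s \<le> s0 * (4 * c + 2)" using s0 by (simp add: x(2))
qed

text \<open>The mean misfit is nonnegative, so minus the logarithm of the evidence is nonnegative
  too, and \<open>reduced\<close> inherits the coercivity of \<open>normal_KL\<close>.\<close>

lemma evidence_bounds:
  assumes "0 \<le> s"
  shows "0 < (\<integral>v. exp (- mean_misfit m s v) \<partial>M)" and "(\<integral>v. exp (- mean_misfit m s v) \<partial>M) \<le> 1"
  using integral_exp_pos[OF prob_M integrable_exp_uminus_nonneg[OF prob_M]]
    integral_exp_uminus_nonneg_le_1[OF prob_M] mean_misfit_nonneg[OF assms] by auto

text \<open>The integrand is at most one, so dominated convergence applies with a constant bound.
  The positive lower end of the interval keeps away from the singularity of \<open>normal_KL\<close>
  at s = 0.\<close>

lemma continuous_on_reduced: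
  assumes "0 < a"
  shows "continuous_on (B \<times> {a..a'}) (\<lambda>p. reduced (fst p) (snd p))"
proof -
  interpret M: prob_space M by (rule prob_M)
  let ?K = "B \<times> {a..a'}"
  have "continuous_on ?K (\<lambda>p. \<integral>v. exp (- mean_misfit (fst p) (snd p) v) \<partial>M)"
  proof (rule continuous_on_sequentiallyI)
    fix u p assume u: "\<forall>n. u n \<in> ?K" and p: "p \<in> ?K" and lim: "u \<longlonglongrightarrow> p"
    show "(\<lambda>n. \<integral>v. exp (- mean_misfit (fst (u n)) (snd (u n)) v) \<partial>M)
      \<longlonglongrightarrow> (\<integral>v. exp (- mean_misfit (fst p) (snd p) v) \<partial>M)"
    proof (rule integral_dominated_convergence[where w = "\<lambda>_. 1"])
      have "(\<lambda>n. exp (- mean_misfit (fst (u n)) (snd (u n)) v)) \<longlonglongrightarrow> exp (- mean_misfit (fst p) (snd p) v)" for v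
        unfolding mean_misfit_def by (intro tendsto_intros lim)
      then show "AE v in M. (\<lambda>n. exp (- mean_misfit (fst (u n)) (snd (u n)) v)) \<longlonglongrightarrow> exp (- mean_misfit (fst p) (snd p) v)"
        by simp
      have "0 \<le> snd (u n)" for n
        using u[rule_format, of n] assms by (auto simp: mem_Times_iff)
      then show "AE v in M. norm (exp (- mean_misfit (fst (u n)) (snd (u n)) v)) \<le> 1" for n
        by (simp add: mean_misfit_nonneg)
    qed simp_all
  qed
  moreover have "(\<integral>v. exp (- mean_misfit (fst p) (snd p) v) \<partial>M) \<noteq> 0" if "p \<in> ?K" for p
    using evidence_bounds(1)[of "snd p" "fst p"] that assms by (auto simp: mem_Times_iff)
  moreover have "continuous_on ?K (\<lambda>p. normal_KL m0 s0 (fst p) (snd p))"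
    unfolding normal_KL_def using assms s0 by (intro continuous_intros) auto
  ultimately show ?thesis
    unfolding reduced_def by (intro continuous_intros) auto
qed

lemma reduced_minimum:
  shows "\<exists>m s. 0 < s \<and> (\<forall>m' s'. 0 < s' \<longrightarrow> reduced m s \<le> reduced m' s')"
proof -
  \<comment> \<open>The value at the parameters of the prior serves as level; the sublevel set is
    nonempty and lies in the box \<open>K\<close> given by \<open>normal_KL_bounds\<close>.\<close>
  define c where "c = reduced m0 s0"
  define a where "a = s0 * exp (- 2 * c - 1)"
  define K where "K = {m0 - (2 * s0 * c + 1)..m0 + (2 * s0 * c + 1)} \<times> {a..s0 * (4 * c + 2)}"
  have a: "0 < a" using s0 by (simp add: a_def)
  have K: "(m, s) \<in> K" if "0 < s" "reduced m s \<le> c" for m s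
  proof -
    have "ln (\<integral>v. exp (- mean_misfit m s v) \<partial>M) \<le> 0"
      using evidence_bounds[of s m] that by simp
    then have "normal_KL m0 s0 m s \<le> c" using that by (simp add: reduced_def)
    from normal_KL_bounds[OF that(1) this] show ?thesis by (auto simp: K_def a_def)
  qed
  have "\<exists>p\<in>K. \<forall>q\<in>K. reduced (fst p) (snd p) \<le> reduced (fst q) (snd q)"
  proof (rule continuous_attains_inf)
    show "compact K" unfolding K_def by (intro compact_Times compact_Icc)
    show "K \<noteq> {}" using K[of s0 m0] s0 by (auto simp: c_def)
    show "continuous_on K (\<lambda>p. reduced (fst p) (snd p))"
      unfolding K_def by (rule continuous_on_reduced[OF a])
  qed
  then obtain m s where p: "(m, s) \<in> K" and min: "\<And>m' s'. (m', s') \<in> K \<Longrightarrow> reduced m s \<le> reduced m' s'"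
    by force
  have "0 < s" using p a by (auto simp: K_def)
  \<comment> \<open>Inside the sublevel set the minimum over \<open>K\<close> applies; outside it,
    the value exceeds \<open>c\<close>, which the minimum does not.\<close>
  moreover have "reduced m s \<le> reduced m' s'" if "0 < s'" for m' s'
    using min[OF K[OF that]] min[OF K[OF s0, of m0]] by (cases "reduced m' s' \<le> c") (auto simp: c_def)
  ultimately show ?thesis by blast
qed

section \<open>The posterior and membership in the approximating classes\<close>

text \<open>With the evidence as a logarithm in the exponent, \<open>KL_pair_tilt\<close> applies
  directly and the evidence becomes its additive constant.\<close>

definition posterior :: "('u \<times> real) measure" where
  "posterior = gibbs (M \<Otimes>\<^sub>M Q) (\<lambda>z. misfit (fst z) (snd z))"

lemma KL_posterior:
  assumes La[measurable]: "La \<in> borel_measurable M" and \<alpha>: "prob_space (tilt M La)"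
      "integrable (tilt M La) (\<lambda>v. (norm v)\<^sup>2)"
    and Lb[measurable]: "Lb \<in> borel_measurable Q" and \<beta>: "prob_space (tilt Q Lb)"
      "integrable (tilt Q Lb) (\<lambda>x. x\<^sup>2)"
  shows "KL (tilt M La \<Otimes>\<^sub>M tilt Q Lb) posterior =
    (if integrable (tilt M La) La \<and> integrable (tilt Q Lb) Lb
     then ereal (free_energy La Lb + ln (\<integral>z. exp (- misfit (fst z) (snd z)) \<partial>(M \<Otimes>\<^sub>M Q))) else \<infinity>)"
proof -
  interpret M: prob_space M by (rule prob_M)
  interpret Q: prob_space Q by (rule prob_Q)
  interpret pair_prob_space M Q ..
  have mm: "(\<lambda>z. misfit (fst z) (snd z)) \<in> borel_measurable (M \<Otimes>\<^sub>M Q)" by measurable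
  have sets: "sets (tilt M La) = sets borel" "sets (tilt Q Lb) = sets borel" by simp_all
  show ?thesis
    unfolding posterior_def free_energy_def
    by (rule KL_pair_tilt[OF prob_M prob_Q La Lb mm \<alpha>(1) \<beta>(1)
          integrable_misfit_pair[OF \<alpha>(1) sets(1) \<alpha>(2) \<beta>(1) sets(2) \<beta>(2)]
          prob_space_gibbs[OF P.prob_space_axioms integrable_exp_uminus_nonneg[OF P.prob_space_axioms mm]]])
      (rule misfit_nonneg)
qed

text \<open>The log-density is continuous, hence bounded on every [-N, N]. The integral in
  \<open>R2\<close> against the prior is an integral against N(m, s) itself, finite because its
  second moment is.\<close>

lemma gaussian_real_approx_class:
  assumes s: "0 < s"
  shows "gaussian_real m s \<in> approx_class T_lam Q"
  unfolding gaussian_real_gibbs(3)[OF s]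
proof (rule approx_classI[OF Q_borel_probs])
  have g: "gaussian_real m s = tilt Q (normal_log_ratio m0 s0 m s)"
    by (rule gaussian_real_eq_tilt[OF s0 s])
  interpret prob_space "gaussian_real m s"
    using gaussian_real_borel_probs[OF s] by (simp add: borel_probs_def)
  have [measurable_cong]: "sets (gaussian_real m s) = sets borel"
    using gaussian_real_borel_probs[OF s] by (simp add: borel_probs_def)
  have "bounded ((\<lambda>x. - normal_log_ratio m0 s0 m s x) ` {- N..N})" for N
    unfolding normal_log_ratio_def using s s0
    by (intro compact_imp_bounded compact_continuous_image continuous_intros compact_Icc) auto
  moreover have "T_lam N = {- N..N}" for N by (auto simp: T_lam_def)
  ultimately show "(\<lambda>x. - normal_log_ratio m0 s0 m s x) \<in> R1 T_lam"
    by (auto simp: R1_def bounded_imp_bdd_above)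
  have "integrable (gaussian_real m s) (\<lambda>x. max 1 ((norm x)\<^sup>2))"
    using normal_moments(1)[OF s] by (intro integrable_max) simp_all
  then have "(\<integral>\<^sup>+x. ennreal (max 1 ((norm x)\<^sup>2)) \<partial>gaussian_real m s) < \<infinity>"
    by (simp add: nn_integral_eq_integral)
  then have "(\<integral>\<^sup>+x. ennreal (exp (normal_log_ratio m0 s0 m s x)) * ennreal (max 1 ((norm x)\<^sup>2)) \<partial>Q) < \<infinity>"
    unfolding g by (subst (asm) nn_integral_density) simp_all
  then show "(\<lambda>x. - normal_log_ratio m0 s0 m s x) \<in> R2 Q"
    by (simp add: R2_def ennreal_mult)
qed

text \<open>The mean misfit is the misfit at \<open>m\<close> plus a variance term, and on
  \<open>T_v N\<close> the operator norm of \<open>H\<close> bounds both.\<close>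

lemma mean_misfit_R1:
  assumes s: "0 \<le> s"
  shows "mean_misfit m s \<in> R1 T_v"
proof -
  have "mean_misfit m s v \<le> \<tau> * (norm d)\<^sup>2 + \<tau> * (onorm H)\<^sup>2 * (m\<^sup>2 * N\<^sup>2) + \<tau> / 2 * (s * (onorm H * N)\<^sup>2)"
    if "v \<in> T_v N" for v N
  proof -
    have v: "norm v \<le> N" using that by (rule T_v_norm_le)
    have "norm (H v) \<le> onorm H * N"
      using onorm[OF H, of v] v onorm_pos_le[OF H] by (meson mult_left_mono order_trans)
    then have "\<tau> / 2 * (s * (norm (H v))\<^sup>2) \<le> \<tau> / 2 * (s * (onorm H * N)\<^sup>2)"
      using s \<tau> by (intro mult_left_mono power_mono) simp_all
    moreover have "\<tau> * (onorm H)\<^sup>2 * (m\<^sup>2 * (norm v)\<^sup>2) \<le> \<tau> * (onorm H)\<^sup>2 * (m\<^sup>2 * N\<^sup>2)"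
      using v \<tau> by (intro mult_left_mono power_mono) simp_all
    moreover have "mean_misfit m s v = misfit v m + \<tau> / 2 * (s * (norm (H v))\<^sup>2)"
      by (simp add: mean_misfit_def misfit_def algebra_simps)
    ultimately show ?thesis using misfit_le[of v m] by linarith
  qed
  then have "bdd_above (mean_misfit m s ` T_v N)" for N by (intro bdd_aboveI2)
  then show ?thesis by (simp add: R1_def)
qed

section \<open>Optimality and the coupled equations\<close>

text \<open>Assumption (A) enters twice, each time to place an averaged misfit in \<open>R2\<close>:
  first the average over \<open>\<beta>\<close>, then the average over
  \<open>\<alpha>\<close>.\<close>

lemma optimal_product:
  assumes A: "\<forall>\<nu>v \<in> approx_class T_v M. \<forall>\<nu>l \<in> approx_class T_lam Q. assumption_A misfit M Q \<nu>v \<nu>l"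
  obtains \<alpha> \<beta> where "\<alpha> \<in> approx_class T_v M" and "\<beta> \<in> approx_class T_lam Q"
    and "\<And>\<alpha>' \<beta>'. \<alpha>' \<in> approx_class T_v M \<Longrightarrow> \<beta>' \<in> approx_class T_lam Q \<Longrightarrow>
      KL (\<alpha> \<Otimes>\<^sub>M \<beta>) posterior \<le> KL (\<alpha>' \<Otimes>\<^sub>M \<beta>') posterior"
    and "\<And>v. integrable \<beta> (\<lambda>l. misfit v l)" and "\<And>l. integrable \<alpha> (\<lambda>v. misfit v l)"
    and "\<alpha> = gibbs M (\<lambda>v. \<integral>l. misfit v l \<partial>\<beta>)" and "\<beta> = gibbs Q (\<lambda>l. \<integral>v. misfit v l \<partial>\<alpha>)"
proof -
  obtain m s where s: "0 < s" and min: "\<And>m' s'. 0 < s' \<Longrightarrow> reduced m s \<le> reduced m' s'"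
    using reduced_minimum by auto
  define R where "R = normal_log_ratio m0 s0 m s"
  define \<beta> where "\<beta> = gaussian_real m s"
  define La where "La v = - mean_misfit m s v - ln (\<integral>v. exp (- mean_misfit m s v) \<partial>M)" for v
  define \<alpha> where "\<alpha> = tilt M La"
  have \<beta>_eq: "\<beta> = tilt Q R"
    unfolding \<beta>_def R_def by (rule gaussian_real_eq_tilt[OF s0 s])
  have [measurable]: "R \<in> borel_measurable borel" "La \<in> borel_measurable borel"
    unfolding R_def La_def by simp_all
  have La: "La \<in> borel_measurable M" and R: "R \<in> borel_measurable Q" by simp_all
  have \<beta>_class: "\<beta> \<in> approx_class T_lam Q"
    unfolding \<beta>_def by (rule gaussian_real_approx_class[OF s])
  have mom: "prob_space \<beta>" "sets \<beta> = sets borel" "integrable \<beta> (\<lambda>x. x\<^sup>2)"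
      "(\<integral>x. x \<partial>\<beta>) = m" "(\<integral>x. (x - m)\<^sup>2 \<partial>\<beta>) = s"
    unfolding \<beta>_def using gaussian_real_borel_probs[OF s] normal_moments[OF s]
    by (simp_all add: borel_probs_def)
  note iR = integrable_normal_log_ratio[OF mom s s0, of m0, folded R_def]
    and eR = integral_normal_log_ratio[OF mom s s0, of m0, folded R_def]
  have mean: "(\<integral>l. misfit v l \<partial>\<beta>) = mean_misfit m s v" for v
    by (rule integral_misfit_right[OF mom])

  \<comment> \<open>Assumption (A) speaks of pairs, while \<open>\<alpha>\<close> is not yet known
    to be in the class. The condition used here concerns only \<open>\<beta>\<close>, so any member
    can serve as its partner.\<close>
  have "assumption_A misfit M Q (gibbs M (\<lambda>x. ln (max 1 ((norm x)\<^sup>2)))) \<beta>"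
    using A \<beta>_class gibbs_ln_max_norm_square_approx_class[OF M T_v_norm_le] by blast
  then have mR2: "mean_misfit m s \<in> R2 M"
    by (simp add: assumption_A_def R2_def mean)
  have \<alpha>_gibbs: "\<alpha> = gibbs M (mean_misfit m s)"
    unfolding \<alpha>_def La_def ..
  have \<alpha>_class: "\<alpha> \<in> approx_class T_v M"
    unfolding \<alpha>_gibbs using s by (intro approx_classI[OF M mean_misfit_R1 mR2]) simp
  have \<alpha>: "prob_space \<alpha>" "sets \<alpha> = sets borel" "integrable \<alpha> (\<lambda>v. (norm v)\<^sup>2)"
    using \<alpha>_class gibbs_square_integrable[OF M mR2]
    by (simp_all add: approx_class_def borel_probs_def \<alpha>_gibbs)
  interpret \<alpha>: prob_space \<alpha> by fact
  interpret \<beta>: prob_space \<beta> by fact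
  interpret \<alpha>\<beta>: pair_prob_space \<alpha> \<beta> ..
  note \<alpha>(2)[measurable_cong] mom(2)[measurable_cong]
  note i = integrable_misfit_pair[OF \<alpha> mom(1-3)]
  have im: "integrable \<alpha> (mean_misfit m s)"
    using \<alpha>\<beta>.integrable_fst'[OF i] by (simp add: mean)
  then have iLa: "integrable \<alpha> La" unfolding La_def by simp
  have em: "(\<integral>z. misfit (fst z) (snd z) \<partial>(\<alpha> \<Otimes>\<^sub>M \<beta>)) = (\<integral>v. mean_misfit m s v \<partial>\<alpha>)"
    using \<alpha>\<beta>.integral_fst'[OF i] by (simp add: mean)
  have eLa: "(\<integral>v. La v \<partial>\<alpha>) = - (\<integral>v. mean_misfit m s v \<partial>\<alpha>) - ln (\<integral>v. exp (- mean_misfit m s v) \<partial>M)"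
    unfolding La_def using im \<alpha>.prob_space by simp
  \<comment> \<open>The averaged misfit in \<open>La\<close> cancels the misfit term, so the lower
    bound is attained at this pair.\<close>
  have F: "free_energy La R = reduced m s"
    unfolding free_energy_def reduced_def
    by (simp add: \<alpha>_def[symmetric] \<beta>_eq[symmetric] eR em eLa)

  have optimal: "KL (\<alpha> \<Otimes>\<^sub>M \<beta>) posterior \<le> KL (\<alpha>' \<Otimes>\<^sub>M \<beta>') posterior"
    if \<alpha>': "\<alpha>' \<in> approx_class T_v M" and \<beta>': "\<beta>' \<in> approx_class T_lam Q" for \<alpha>' \<beta>'
  proof -
    obtain La' where La': "La' \<in> borel_measurable M" "\<alpha>' = tilt M La'" "prob_space \<alpha>'"
        "integrable \<alpha>' (\<lambda>x. (norm x)\<^sup>2)"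
      by (rule approx_classE[OF M \<alpha>'])
    obtain Lb' where Lb': "Lb' \<in> borel_measurable Q" "\<beta>' = tilt Q Lb'" "prob_space \<beta>'"
        "integrable \<beta>' (\<lambda>x. (norm x)\<^sup>2)"
      by (rule approx_classE[OF Q_borel_probs \<beta>'])
    have Lb'': "integrable \<beta>' (\<lambda>x. x\<^sup>2)" using Lb'(4) by simp
    \<comment> \<open>Only competitors with integrable log-densities matter; for all others the
      divergence is infinite.\<close>
    have le: "free_energy La R \<le> free_energy La' Lb'"
      if fin: "integrable \<alpha>' La'" "integrable \<beta>' Lb'"
    proof -
      obtain m' s' where "0 < s'" "reduced m' s' \<le> free_energy La' Lb'"
        using reduced_le_free_energy[OF La'(1) La'(3,4)[unfolded La'(2)] _ Lb'(1) Lb'(3)[unfolded Lb'(2)] Lb''[unfolded Lb'(2)]]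
          fin unfolding La'(2) Lb'(2) by auto
      then show ?thesis using min[of s' m'] F by simp
    qed
    show ?thesis
      using KL_posterior[OF La \<alpha>(1,3)[unfolded \<alpha>_def] R mom(1,3)[unfolded \<beta>_eq]]
        KL_posterior[OF La'(1) La'(3,4)[unfolded La'(2)] Lb'(1) Lb'(3)[unfolded Lb'(2)] Lb''[unfolded Lb'(2)]]
        iLa iR le by (simp flip: \<alpha>_def \<beta>_eq La'(2) Lb'(2))
  qed

  define f where "f l = (\<integral>v. misfit v l \<partial>\<alpha>)" for l
  have f[measurable]: "f \<in> borel_measurable borel"
  proof -
    have "(\<lambda>(l, v). misfit v l) \<in> borel_measurable (borel \<Otimes>\<^sub>M \<alpha>)"
      unfolding misfit_def by measurable
    then show ?thesis unfolding f_def by (rule \<alpha>.borel_measurable_lebesgue_integral)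
  qed
  have f0: "0 \<le> f l" for l unfolding f_def by (simp add: misfit_nonneg)
  have fQ: "f \<in> borel_measurable Q" by simp
  note ief = integrable_exp_uminus_nonneg[OF prob_Q fQ f0]
  have "integrable \<beta> f" "(\<integral>l. f l \<partial>\<beta>) = (\<integral>v. mean_misfit m s v \<partial>\<alpha>)"
    unfolding f_def using \<alpha>\<beta>.integrable_snd[of "\<lambda>v l. misfit v l"] \<alpha>\<beta>.integral_snd[of "\<lambda>v l. misfit v l"] i em
    by (simp_all add: case_prod_beta')
  note if_ = this
  have "assumption_A misfit M Q \<alpha> \<beta>" using A \<alpha>_class \<beta>_class by blast
  then have fR2: "f \<in> R2 Q"
    by (simp add: assumption_A_def R2_def f_def[symmetric])
  define L2 where "L2 l = - f l - ln (\<integral>l. exp (- f l) \<partial>Q)" for l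
  have L2: "L2 \<in> borel_measurable Q" unfolding L2_def by simp
  \<comment> \<open>The best second factor for the fixed \<open>\<alpha>\<close>, by the variational
    principle. Its finite second moment, from \<open>fR2\<close>, lets
    \<open>reduced_le_free_energy\<close> apply to it.\<close>
  define \<beta>2 where "\<beta>2 = tilt Q L2"
  have \<beta>2_gibbs: "\<beta>2 = gibbs Q f" unfolding \<beta>2_def L2_def ..
  have \<beta>2: "prob_space \<beta>2" "sets \<beta>2 = sets borel" "integrable \<beta>2 (\<lambda>x. x\<^sup>2)"
    using prob_space_gibbs[OF prob_Q ief] gibbs_square_integrable[OF Q_borel_probs fR2]
    unfolding \<beta>2_gibbs by simp_all
  interpret \<beta>2: prob_space \<beta>2 by fact
  interpret \<alpha>\<beta>2: pair_prob_space \<alpha> \<beta>2 ..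
  note i2 = integrable_misfit_pair[OF \<alpha> \<beta>2]
  have f2: "integrable \<beta>2 f" "(\<integral>l. f l \<partial>\<beta>2) = (\<integral>z. misfit (fst z) (snd z) \<partial>(\<alpha> \<Otimes>\<^sub>M \<beta>2))"
    unfolding f_def using \<alpha>\<beta>2.integrable_snd[of "\<lambda>v l. misfit v l"] \<alpha>\<beta>2.integral_snd[of "\<lambda>v l. misfit v l"] i2
    by (simp_all add: case_prod_beta')
  have iL2: "integrable \<beta>2 L2" unfolding L2_def using f2 by simp
  have eL2: "(\<integral>l. L2 l \<partial>\<beta>2) = - (\<integral>l. f l \<partial>\<beta>2) - ln (\<integral>l. exp (- f l) \<partial>Q)"
    unfolding L2_def using f2 \<beta>2.prob_space by simp
  have F2: "free_energy La L2 = (\<integral>v. La v \<partial>\<alpha>) - ln (\<integral>l. exp (- f l) \<partial>Q)"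
    by (simp add: free_energy_def \<alpha>_def[symmetric] \<beta>2_def[symmetric] eL2 f2(2))
  obtain m' s' where "0 < s'" "reduced m' s' \<le> free_energy La L2"
    using reduced_le_free_energy[OF La \<alpha>(1,3)[unfolded \<alpha>_def] iLa[unfolded \<alpha>_def] L2 \<beta>2(1,3)[unfolded \<beta>2_def] iL2[unfolded \<beta>2_def]] by auto
  \<comment> \<open>Minimality of \<open>(m, s)\<close> shows that \<open>\<beta>\<close> does at
    least as well as \<open>\<beta>2\<close>; cancelling the common \<open>La\<close> term leaves
    the inequality opposite to the variational one.\<close>
  then have "free_energy La R \<le> free_energy La L2" using min[of s' m'] F by simp
  then have "(\<integral>l. R l \<partial>\<beta>) + (\<integral>l. f l \<partial>\<beta>) \<le> - ln (\<integral>l. exp (- f l) \<partial>Q)"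
    unfolding F2 by (simp add: free_energy_def em if_(2) flip: \<alpha>_def \<beta>_eq)
  moreover note gibbs_variational_le[OF prob_Q R fQ mom(1)[unfolded \<beta>_eq] ief iR[unfolded \<beta>_eq] if_(1)[unfolded \<beta>_eq]]
  ultimately have "\<beta> = gibbs Q f"
    unfolding \<beta>_eq
    by (intro gibbs_variational_eq[OF prob_Q R fQ mom(1)[unfolded \<beta>_eq] ief iR[unfolded \<beta>_eq] if_(1)[unfolded \<beta>_eq]])
      simp
  then have \<beta>_stationary: "\<beta> = gibbs Q (\<lambda>l. \<integral>v. misfit v l \<partial>\<alpha>)"
    unfolding f_def .
  have \<alpha>_stationary: "\<alpha> = gibbs M (\<lambda>v. \<integral>l. misfit v l \<partial>\<beta>)"
    unfolding mean by (rule \<alpha>_gibbs)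
  show ?thesis
    by (rule that[OF \<alpha>_class \<beta>_class optimal integrable_misfit_right[OF mom]
          integrable_misfit_left[OF \<alpha>] \<alpha>_stationary \<beta>_stationary])
qed

end

section \<open>From the optimal pair to the stated densities\<close>

theorem theorem2p3:
  fixes H :: "'u::{real_inner, complete_space, second_countable_topology} \<Rightarrow> real^'n"
    and d :: "real^'n"
    and \<Gamma> :: "real^'n^'n"
    and C0 :: "'u \<Rightarrow> 'u"
    and \<tau> \<sigma> lbar Z :: real
    and \<Phi> :: "'u \<Rightarrow> real \<Rightarrow> real"
    and \<mu>0v :: "'u measure"
    and \<mu>0l :: "real measure"
    and \<mu>0 \<mu> :: "('u \<times> real) measure"
  assumes "bounded_linear H"
    and "\<tau> > 0" and "\<Gamma> = mat (inverse \<tau>)"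
    and "pos_def_op C0" and "symmetric_op C0" and "trace_class_op C0"
    and "\<sigma> > 0"
    and "is_gaussian 0 C0 \<mu>0v"
    and "\<mu>0l = gaussian_real lbar \<sigma>"
    and "\<mu>0 = \<mu>0v \<Otimes>\<^sub>M \<mu>0l"
    and "\<Phi> = potential \<Gamma> d H"
    and "\<mu> \<in> borel_probs"
    and "Z = (\<integral>(v, l). exp (- \<Phi> v l) \<partial>\<mu>0)"
    and "has_RN_deriv \<mu> \<mu>0 (\<lambda>(v, l). 1 / Z * exp (- \<Phi> v l))"
    and "\<forall>\<nu>v \<in> approx_class T_v \<mu>0v. \<forall>\<nu>l \<in> approx_class T_lam \<mu>0l.
           assumption_A \<Phi> \<mu>0v \<mu>0l \<nu>v \<nu>l"
  shows "\<exists>\<nu>v \<nu>l \<Phi>v \<Phi>l.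
      is_arg_min (\<lambda>(\<alpha>, \<beta>). KL (\<alpha> \<Otimes>\<^sub>M \<beta>) \<mu>)
        (\<lambda>(\<alpha>, \<beta>). \<alpha> \<in> approx_class T_v \<mu>0v \<and> \<beta> \<in> approx_class T_lam \<mu>0l) (\<nu>v, \<nu>l) \<and>
      \<nu>v \<Otimes>\<^sub>M \<nu>l \<in> borel_probs \<and>
      (\<exists>c>0. has_RN_deriv (\<nu>v \<Otimes>\<^sub>M \<nu>l) \<mu>0 (\<lambda>(v, l). c * exp (- (\<Phi>v v + \<Phi>l l)))) \<and>
      (\<forall>v. integrable \<nu>l (\<lambda>l. \<Phi> v l)) \<and>
      (\<exists>const. \<forall>v. \<Phi>v v = (\<integral>l. \<Phi> v l \<partial>\<nu>l) + const) \<and>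
      (\<forall>l. integrable \<nu>v (\<lambda>v. \<Phi> v l)) \<and>
      (\<exists>const. \<forall>l. \<Phi>l l = (\<integral>v. \<Phi> v l \<partial>\<nu>v) + const) \<and>
      (\<exists>c>0. \<nu>v = density \<mu>0v (\<lambda>v. ennreal (c * exp (- \<Phi>v v)))) \<and>
      (\<exists>c>0. \<nu>l = density \<mu>0l (\<lambda>l. ennreal (c * exp (- \<Phi>l l))))"
proof -
  have M: "\<mu>0v \<in> borel_probs" using assms(8) by (simp add: is_gaussian_def)
  interpret R: bilinear_inverse_problem H d \<tau> lbar \<sigma> \<mu>0v
    by (intro bilinear_inverse_problem.intro assms(1,2,7) M)
  have \<Phi>: "\<Phi> = R.misfit"
    unfolding assms(11,3) by (intro ext) (simp add: potential_white_noise assms(2) R.misfit_def)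
  let ?Q = "gaussian_real lbar \<sigma>"
  interpret M: prob_space \<mu>0v by (rule R.prob_M)
  interpret Q: prob_space ?Q by (rule R.prob_Q)
  interpret P: pair_prob_space \<mu>0v ?Q ..
  have [measurable]: "(\<lambda>z. R.misfit (fst z) (snd z)) \<in> borel_measurable (\<mu>0v \<Otimes>\<^sub>M ?Q)"
    by measurable
  have iP: "integrable (\<mu>0v \<Otimes>\<^sub>M ?Q) (\<lambda>z. exp (- R.misfit (fst z) (snd z)))"
    by (intro integrable_exp_uminus_nonneg P.P.prob_space_axioms R.misfit_nonneg) measurable
  \<comment> \<open>The evidence \<open>Z\<close> is the normaliser inside \<open>gibbs\<close>, so
    both measures have the same density with respect to the product prior.\<close>
  have \<mu>: "\<mu> = R.posterior"
    unfolding R.posterior_def tilt_normalized[OF P.P.prob_space_axioms iP]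
    by (intro density_has_RN_deriv P.P.sigma_finite_measure_axioms)
      (use assms(9,10,13,14) in \<open>simp_all add: \<Phi> case_prod_beta'\<close>)
  have A: "\<forall>\<nu>v \<in> approx_class T_v \<mu>0v. \<forall>\<nu>l \<in> approx_class T_lam ?Q. assumption_A R.misfit \<mu>0v ?Q \<nu>v \<nu>l"
    using assms(15) unfolding \<Phi> assms(9) .
  obtain \<alpha> \<beta> where members: "\<alpha> \<in> approx_class T_v \<mu>0v" "\<beta> \<in> approx_class T_lam ?Q"
    and optimal: "\<And>\<alpha>' \<beta>'. \<alpha>' \<in> approx_class T_v \<mu>0v \<Longrightarrow> \<beta>' \<in> approx_class T_lam ?Q \<Longrightarrow>
      KL (\<alpha> \<Otimes>\<^sub>M \<beta>) R.posterior \<le> KL (\<alpha>' \<Otimes>\<^sub>M \<beta>') R.posterior"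
    and int: "\<And>v. integrable \<beta> (\<lambda>l. R.misfit v l)" "\<And>l. integrable \<alpha> (\<lambda>v. R.misfit v l)"
    and \<alpha>: "\<alpha> = gibbs \<mu>0v (\<lambda>v. \<integral>l. R.misfit v l \<partial>\<beta>)"
    and \<beta>: "\<beta> = gibbs ?Q (\<lambda>l. \<integral>v. R.misfit v l \<partial>\<alpha>)"
    by (rule R.optimal_product[OF A]) (rule that)
  \<comment> \<open>These are the potentials with both additive constants equal to zero; the
    normalisation goes into the factors \<open>cv\<close> and \<open>cl\<close> below.\<close>
  define f where "f v = (\<integral>l. R.misfit v l \<partial>\<beta>)" for v
  define g where "g l = (\<integral>v. R.misfit v l \<partial>\<alpha>)" for l
  have prob: "prob_space \<alpha>" "sets \<alpha> = sets borel" "prob_space \<beta>" "sets \<beta> = sets borel"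
    using members by (auto simp: approx_class_def borel_probs_def)
  interpret \<alpha>: prob_space \<alpha> by fact
  interpret \<beta>: prob_space \<beta> by fact
  interpret \<alpha>\<beta>: pair_prob_space \<alpha> \<beta> ..
  note prob(2)[measurable_cong] prob(4)[measurable_cong]
  have "(\<lambda>(v, l). R.misfit v l) \<in> borel_measurable (borel \<Otimes>\<^sub>M \<beta>)"
    unfolding R.misfit_def by measurable
  then have [measurable]: "f \<in> borel_measurable borel"
    unfolding f_def by (rule \<beta>.borel_measurable_lebesgue_integral)
  have "(\<lambda>(l, v). R.misfit v l) \<in> borel_measurable (borel \<Otimes>\<^sub>M \<alpha>)"
    unfolding R.misfit_def by measurable
  then have [measurable]: "g \<in> borel_measurable borel"
    unfolding g_def by (rule \<alpha>.borel_measurable_lebesgue_integral)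
  have ef: "integrable \<mu>0v (\<lambda>v. exp (- f v))"
    by (rule integrable_exp_uminus_nonneg[OF R.prob_M]) (simp, simp add: f_def R.misfit_nonneg)
  have eg: "integrable ?Q (\<lambda>l. exp (- g l))"
    by (rule integrable_exp_uminus_nonneg[OF R.prob_Q]) (simp, simp add: g_def R.misfit_nonneg)
  define cv where "cv = 1 / (\<integral>v. exp (- f v) \<partial>\<mu>0v)"
  define cl where "cl = 1 / (\<integral>l. exp (- g l) \<partial>?Q)"
  have c: "0 < cv" "0 < cl"
    unfolding cv_def cl_def using integral_exp_pos[OF R.prob_M ef] integral_exp_pos[OF R.prob_Q eg] by simp_all
  have \<alpha>_density: "\<alpha> = density \<mu>0v (\<lambda>v. ennreal (cv * exp (- f v)))"
    using \<alpha> tilt_normalized[OF R.prob_M ef] by (simp add: f_def[abs_def] cv_def)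
  have \<beta>_density: "\<beta> = density ?Q (\<lambda>l. ennreal (cl * exp (- g l)))"
    using \<beta> tilt_normalized[OF R.prob_Q eg] by (simp add: g_def[abs_def] cl_def)
  have "\<alpha> \<Otimes>\<^sub>M \<beta> = density (\<mu>0v \<Otimes>\<^sub>M ?Q) (\<lambda>(v, l). ennreal (cv * exp (- f v)) * ennreal (cl * exp (- g l)))"
    unfolding \<alpha>_density \<beta>_density
    by (intro pair_measure_density Q.sigma_finite_measure_axioms)
      (auto simp flip: \<beta>_density intro: \<beta>.sigma_finite_measure_axioms)
  also have "\<dots> = density (\<mu>0v \<Otimes>\<^sub>M ?Q) (\<lambda>z. ennreal (case z of (v, l) \<Rightarrow> cv * cl * exp (- (f v + g l))))"
    using c by (intro density_cong)
      (auto simp: ennreal_mult[symmetric] exp_diff exp_minus field_simps case_prod_beta')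
  finally have deriv: "has_RN_deriv (\<alpha> \<Otimes>\<^sub>M \<beta>) (\<mu>0v \<Otimes>\<^sub>M ?Q) (\<lambda>(v, l). cv * cl * exp (- (f v + g l)))"
    by (simp only:) (intro has_RN_deriv_density P.P.sigma_finite_measure_axioms, simp add: case_prod_beta')
  have "sets (\<alpha> \<Otimes>\<^sub>M \<beta>) = sets borel"
    using sets_pair_measure_cong[OF prob(2,4)] unfolding borel_prod .
  then have product: "\<alpha> \<Otimes>\<^sub>M \<beta> \<in> borel_probs"
    using \<alpha>\<beta>.P.prob_space_axioms by (simp add: borel_probs_def)
  show ?thesis
    unfolding \<Phi> \<mu> assms(9,10)
  proof (intro exI[of _ \<alpha>] exI[of _ \<beta>] exI[of _ f] exI[of _ g] conjI)
    show "is_arg_min (\<lambda>(\<alpha>, \<beta>). KL (\<alpha> \<Otimes>\<^sub>M \<beta>) R.posterior)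
        (\<lambda>(\<alpha>, \<beta>). \<alpha> \<in> approx_class T_v \<mu>0v \<and> \<beta> \<in> approx_class T_lam ?Q) (\<alpha>, \<beta>)"
      \<comment> \<open>What is asked is that no admissible pair has a strictly smaller divergence,
        which contradicts \<open>optimal\<close> in the linear order of
        \<open>ereal\<close>.\<close>
      unfolding is_arg_min_def
    proof (intro conjI notI)
      assume "\<exists>p. (case p of (\<alpha>, \<beta>) \<Rightarrow> \<alpha> \<in> approx_class T_v \<mu>0v \<and> \<beta> \<in> approx_class T_lam ?Q) \<and>
        (case p of (\<alpha>, \<beta>) \<Rightarrow> KL (\<alpha> \<Otimes>\<^sub>M \<beta>) R.posterior) <
        (case (\<alpha>, \<beta>) of (\<alpha>, \<beta>) \<Rightarrow> KL (\<alpha> \<Otimes>\<^sub>M \<beta>) R.posterior)"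
      then obtain \<alpha>' \<beta>' where "\<alpha>' \<in> approx_class T_v \<mu>0v" "\<beta>' \<in> approx_class T_lam ?Q"
        and less: "KL (\<alpha>' \<Otimes>\<^sub>M \<beta>') R.posterior < KL (\<alpha> \<Otimes>\<^sub>M \<beta>) R.posterior"
        by auto
      then have "KL (\<alpha> \<Otimes>\<^sub>M \<beta>) R.posterior \<le> KL (\<alpha>' \<Otimes>\<^sub>M \<beta>') R.posterior"
        by (intro optimal)
      with less show False by (meson leD)
    qed (use members in simp)
    show "\<alpha> \<Otimes>\<^sub>M \<beta> \<in> borel_probs" by (rule product)
    show "\<exists>c>0. has_RN_deriv (\<alpha> \<Otimes>\<^sub>M \<beta>) (\<mu>0v \<Otimes>\<^sub>M ?Q) (\<lambda>(v, l). c * exp (- (f v + g l)))"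
      using deriv c by (intro exI[of _ "cv * cl"] conjI) simp_all
    show "\<forall>v. integrable \<beta> (R.misfit v)" "\<forall>l. integrable \<alpha> (\<lambda>v. R.misfit v l)"
      using int by blast+
    show "\<exists>const. \<forall>v. f v = (\<integral>l. R.misfit v l \<partial>\<beta>) + const"
      "\<exists>const. \<forall>l. g l = (\<integral>v. R.misfit v l \<partial>\<alpha>) + const"
      by (rule exI[of _ 0], simp add: f_def g_def)+
    show "\<exists>c>0. \<alpha> = density \<mu>0v (\<lambda>v. ennreal (c * exp (- f v)))"
      using \<alpha>_density c by blast
    show "\<exists>c>0. \<beta> = density ?Q (\<lambda>l. ennreal (c * exp (- g l)))"
      using \<beta>_density c by blast
  qed
qed

end
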